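(* Let $0<|q|<1$. Then $$\vartheta_3(0,-q)^{16}=\tfrac13\det\begin{pmatrix}16U_1-2&16U_3+1\\16U_3+1&16U_5-2\end{pmatrix}$$ and $$\vartheta_3(0,-q)^{24}=\tfrac1{3^2}\det\begin{pmatrix}16G_3+1&16G_5-2\\32G_5-4&32G_7+17\end{pmatrix}.$$
   Context: $\vartheta_3(0,q):=\sum_{j=-\infty}^{\infty}q^{j^2}$, so $\vartheta_3(0,-q)=\sum_{j=-\infty}^{\infty}(-1)^{j}q^{j^2}$. For a positive integer $s$, $$U_s\equiv U_s(q):=\sum_{r=1}^{\infty}(-1)^{r-1}\frac{r^sq^r}{1+q^r},\qquad G_s\equiv G_s(q):=\sum_{r=1}^{\infty}(-1)^{r}\frac{r^sq^r}{1-q^r}.$$ *)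

theory Defs
  imports "HOL-Analysis.Analysis"
begin

text \<open>
  All series below converge absolutely for \<^term>\<open>norm (q::complex) < 1\<close>, so the unordered sums
  agree with the usual ordered ones.
\<close>

definition theta3_null :: "complex \<Rightarrow> complex" where
  "theta3_null q = (\<Sum>\<^sub>\<infinity>j\<in>(UNIV :: int set). q powi (j\<^sup>2))"

definition U :: "nat \<Rightarrow> complex \<Rightarrow> complex" where
  "U s q = (\<Sum>\<^sub>\<infinity>r\<in>{1::nat..}. (-1) ^ (r - 1) * (of_nat r ^ s * q ^ r / (1 + q ^ r)))"

definition G :: "nat \<Rightarrow> complex \<Rightarrow> complex" where
  "G s q = (\<Sum>\<^sub>\<infinity>r\<in>{1::nat..}. (-1) ^ r * (of_nat r ^ s * q ^ r / (1 - q ^ r)))"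

end

theory Submission
  imports Defs
begin

text \<open>
  For \<open>|q| < |x| < 1\<close> put \<open>\<Phi>(x) = \<Sum>\<^sub>n x\<^sup>n / (1 + q\<^sup>n)\<close>, the sum being over all integers.  Partial fractions
  turn the Laurent coefficients of \<open>\<Phi>\<^sup>2\<close> and \<open>\<Phi>\<^sup>3\<close> into telescoping sums; with \<open>x = - exp t\<close> this gives
  \<open>\<Phi>\<^sup>2 = S + \<Sum>\<^sub>n n x\<^sup>n / (1 - q\<^sup>n)\<close> and \<open>\<Phi>'' = 2 \<Phi>\<^sup>3 - 2 E \<Phi>\<close> for constants \<open>S\<close>, \<open>E\<close>.  Both functions
  continue across \<open>t = 0\<close>, where \<open>\<Phi>\<close> is odd with first, third and fifth derivative
  \<open>d\<^sub>1 = 2 U\<^sub>1 - 1/4\<close>, \<open>d\<^sub>3 = 2 U\<^sub>3 + 1/8\<close>, \<open>d\<^sub>5 = 2 U\<^sub>5 - 1/4\<close>, and the derivatives of \<open>\<Phi>\<^sup>2\<close> are of the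
  same kind in the \<open>G\<^sub>s\<close>.  The differential equation yields \<open>d\<^sub>1 d\<^sub>5 - d\<^sub>3\<^sup>2 = 12 d\<^sub>1\<^sup>4\<close>, so both determinants
  are powers of \<open>d\<^sub>1\<close> up to constants.

  It remains to see \<open>d\<^sub>1 = - \<theta>\<^sup>4 / 4\<close> for \<open>\<theta> = \<vartheta>\<^sub>3(0, -q)\<close>.  Let \<open>q = p\<^sup>2\<close> and \<open>\<vartheta>(x) = \<Sum>\<^sub>n p\<^bsup>n\<^sup>2 - n\<^esup> x\<^sup>n\<close>.
  Comparing coefficients, \<open>\<Phi>(x) \<vartheta>(-x)\<close> is a constant multiple of \<open>\<vartheta>(x)\<close>; the behaviour at \<open>x = 1\<close> and
  \<open>x = -1\<close> gives \<open>d\<^sub>1 = - (X / Y)\<^sup>2\<close> with \<open>X = \<vartheta>'(-1)\<close>, \<open>Y = \<vartheta>(1)\<close>.  The quotient \<open>2 X / (\<theta>\<^sup>2 Y)\<close> is unchanged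
  under \<open>p \<mapsto> p\<^sup>2\<close> and tends to 1 as \<open>p\<close> tends to 0, hence it is 1; this replaces Jacobi's triple product.
\<close>

subsection \<open>Unordered double sums and sums over the integers\<close>

lemma summable_on_times:
  fixes f :: "'a \<Rightarrow> complex" and g :: "'b \<Rightarrow> complex"
  assumes "f summable_on A" "g summable_on B"
  shows "(\<lambda>(i, j). f i * g j) summable_on A \<times> B"
proof -
  have f: "(\<lambda>i. norm (f i)) summable_on A" and g: "(\<lambda>j. norm (g j)) summable_on B"
    using assms by (simp_all add: summable_on_iff_abs_summable_on_complex)
  have "(\<lambda>ij. norm (case ij of (i, j) \<Rightarrow> f i * g j)) summable_on (SIGMA i:A. B)"
  proof (rule summable_on_SigmaI)
    show "((\<lambda>j. norm (case (i, j) of (i, j) \<Rightarrow> f i * g j)) has_sum norm (f i) * (\<Sum>\<^sub>\<infinity>j\<in>B. norm (g j))) B"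
      if "i \<in> A" for i
      using has_sum_cmult_right[OF has_sum_infsum[OF g], of "norm (f i)"] by (simp add: norm_mult)
    show "(\<lambda>i. norm (f i) * (\<Sum>\<^sub>\<infinity>j\<in>B. norm (g j))) summable_on A"
      using f by (rule summable_on_cmult_left)
  qed auto
  thus ?thesis by (rule abs_summable_summable)
qed

lemma has_sum_times:
  fixes f :: "'a \<Rightarrow> complex" and g :: "'b \<Rightarrow> complex"
  assumes "(f has_sum s) A" "(g has_sum t) B"
  shows "((\<lambda>(i, j). f i * g j) has_sum s * t) (A \<times> B)"
proof (rule has_sum_SigmaI)
  show "((\<lambda>j. case (i, j) of (i, j) \<Rightarrow> f i * g j) has_sum f i * t) B" for i
    using has_sum_cmult_right[OF assms(2), of "f i"] by simp
  show "((\<lambda>i. f i * t) has_sum s * t) A"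
    by (rule has_sum_cmult_left[OF assms(1)])
  show "(\<lambda>(i, j). f i * g j) summable_on A \<times> B"
    using assms by (intro summable_on_times) (auto simp: summable_on_def)
qed

text \<open>The pairs of summation indices are regrouped by their sum \<open>n\<close>. This is a
  bijective reindexing of an absolutely convergent double sum, and Fubini supplies the inner
  sums.\<close>

lemma has_sum_convolution:
  fixes f g :: "int \<Rightarrow> complex"
  assumes "(f has_sum s) UNIV" "(g has_sum t) UNIV"
  shows "((\<lambda>n. \<Sum>\<^sub>\<infinity>k. f k * g (n - k)) has_sum s * t) UNIV"
    and "(\<lambda>k. f k * g (n - k)) summable_on UNIV"
proof -
  let ?h = "\<lambda>(n, k). f k * g (n - k)"
  have *: "(?h has_sum s * t) (UNIV \<times> UNIV)"
    using has_sum_times[OF assms]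
    by (subst has_sum_reindex_bij_witness[of _ "\<lambda>(i, j). (i + j, i)" "\<lambda>(n, k). (k, n - k)"
          "UNIV \<times> UNIV" "\<lambda>(i, j). f i * g j" _ _ "s * t"]) auto
  hence sm: "?h summable_on (UNIV \<times> UNIV)" by (auto simp: summable_on_def)
  have sk: "(\<lambda>k. f k * g (n - k)) summable_on UNIV" for n
    using summable_on_SigmaD1[of "\<lambda>n k. f k * g (n - k)" UNIV "\<lambda>_. UNIV" n] sm by simp
  show "(\<lambda>k. f k * g (n - k)) summable_on UNIV" by (rule sk)
  show "((\<lambda>n. \<Sum>\<^sub>\<infinity>k. f k * g (n - k)) has_sum s * t) UNIV"
    by (rule has_sum_SigmaD[OF *]) (use sk in auto)
qed

lemma has_sum_int_split:
  fixes g :: "int \<Rightarrow> 'a :: banach"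
  assumes "((\<lambda>n. g (int n)) has_sum s) UNIV" "((\<lambda>n. g (- int n)) has_sum t) {1..}"
  shows "(g has_sum s + t) UNIV"
proof -
  have "(g has_sum s) {0..}"
    by (subst has_sum_reindex_bij_witness[of _ int nat UNIV "\<lambda>n. g (int n)" _ _ s])
       (use assms in auto)
  moreover have "(g has_sum t) {..<0}"
    by (subst has_sum_reindex_bij_witness[of _ "\<lambda>n. - int n" "\<lambda>n. nat (- n)" "{1..}" "\<lambda>n. g (- int n)" _ _ t])
       (use assms in auto)
  moreover have "{0..} \<inter> {..<0::int} = {}" "{0..} \<union> {..<0::int} = UNIV" by auto
  ultimately show ?thesis
    using has_sum_Un_disjoint by metis
qed

lemma summable_on_int_iff:
  fixes g :: "int \<Rightarrow> 'a :: banach"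
  shows "g summable_on UNIV \<longleftrightarrow>
    (\<lambda>n. g (int n)) summable_on UNIV \<and> (\<lambda>n. g (- int n)) summable_on {1..}" (is "?l \<longleftrightarrow> ?r")
proof
  assume ?l
  hence 1: "g summable_on {0..}" and 2: "g summable_on {..<0}"
    by (auto intro: summable_on_subset_banach)
  show ?r
  proof
    show "(\<lambda>n. g (int n)) summable_on UNIV"
      by (subst summable_on_reindex_bij_witness[of _ nat int "{0..}" g]) (use 1 in auto)
    show "(\<lambda>n. g (- int n)) summable_on {1..}"
      by (subst summable_on_reindex_bij_witness[of _ "\<lambda>n. nat (- n)" "\<lambda>n. - int n" "{..<0}" g]) (use 2 in auto)
  qed
next
  assume ?r
  thus ?l using has_sum_int_split unfolding summable_on_def by blast
qed

lemma infsum_int_split: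
  fixes g :: "int \<Rightarrow> 'a :: banach"
  assumes "g summable_on UNIV"
  shows "infsum g UNIV = (\<Sum>\<^sub>\<infinity>n. g (int n)) + (\<Sum>\<^sub>\<infinity>n\<in>{1..}. g (- int n))"
  using assms summable_on_int_iff[of g] by (intro infsumI has_sum_int_split) auto

lemma infsum_even_int:
  fixes g :: "int \<Rightarrow> 'a :: banach"
  assumes "g summable_on UNIV" "\<And>n. g (- n) = g n" "g 0 = 0"
  shows "infsum g UNIV = (\<Sum>\<^sub>\<infinity>n\<in>{1..}. g (int n)) + (\<Sum>\<^sub>\<infinity>n\<in>{1..}. g (int n))"
proof -
  have "(\<Sum>\<^sub>\<infinity>n. g (int n)) = (\<Sum>\<^sub>\<infinity>n\<in>{1..}. g (int n))"
    by (rule infsum_cong_neutral) (use assms(3) in \<open>auto simp: not_le\<close>)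
  thus ?thesis using infsum_int_split[OF assms(1)] by (simp add: assms)
qed

text \<open>The derivative appears only as \<open>z * D\<close>: the Euler operator z d/dz
  multiplies the n-th coefficient by n without shifting indices, so it can be iterated and carried
  over to negative powers.\<close>

lemma power_series_theta:
  fixes c :: "nat \<Rightarrow> complex"
  assumes "\<And>y. norm y < K \<Longrightarrow> (\<lambda>n. c n * y ^ n) summable_on UNIV" and z: "norm z < K"
  shows "(\<lambda>n. of_nat n * c n * z ^ n) summable_on UNIV"
    and "\<exists>D. ((\<lambda>z. \<Sum>\<^sub>\<infinity>n. c n * z ^ n) has_field_derivative D) (at z) \<and>
             z * D = (\<Sum>\<^sub>\<infinity>n. of_nat n * c n * z ^ n)"
proof -
  have sm: "summable (\<lambda>n. c n * y ^ n)" if "norm y < K" for y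
    using assms(1)[OF that] by (rule summable_on_imp_summable)
  have smd: "summable (\<lambda>n. diffs c n * y ^ n)" if "norm y < K" for y
    using termdiff_converges[OF that, of c] sm by simp
  have smc: "summable (\<lambda>n. (of_nat n * c n) * y ^ n)" if "norm y < K" for y
  proof -
    have "summable (\<lambda>n. y * (of_nat n * c n * y ^ (n - Suc 0)))"
      using diffs_equiv[OF smd[OF that]] by (intro summable_mult) (auto simp: sums_iff)
    moreover have "y * (of_nat n * c n * y ^ (n - Suc 0)) = (of_nat n * c n) * y ^ n" for n
      by (cases n) auto
    ultimately show ?thesis by simp
  qed
  \<comment> \<open>Convergence at a radius strictly beyond \<open>norm z\<close> becomes absolute
    convergence at \<open>z\<close>.\<close>
  obtain L where L: "norm z < L" "L < K" using z dense by blast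
  have "norm (complex_of_real L) < K" using L by (smt (verit) norm_ge_zero norm_of_real)
  hence absc: "summable (\<lambda>n. norm ((of_nat n * c n) * z ^ n))"
    by (rule powser_insidea[OF smc]) (use L in auto)
  thus so: "(\<lambda>n. of_nat n * c n * z ^ n) summable_on UNIV"
    by (rule norm_summable_imp_summable_on)
  have eq: "(\<Sum>n. c n * y ^ n) = (\<Sum>\<^sub>\<infinity>n. c n * y ^ n)" if "norm y < K" for y
    using has_sum_imp_sums[OF has_sum_infsum[OF assms(1)[OF that]]] by (simp add: sums_iff)
  have "((\<lambda>z. \<Sum>n. c n * z ^ n) has_field_derivative (\<Sum>n. diffs c n * z ^ n)) (at z)"
    by (rule termdiffs_strong'[OF sm z])
  hence 1: "((\<lambda>z. \<Sum>\<^sub>\<infinity>n. c n * z ^ n) has_field_derivative (\<Sum>n. diffs c n * z ^ n)) (at z)"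
    by (rule has_field_derivative_transform_within_open[where S = "ball 0 K"])
       (use z eq in auto)
  have "(\<lambda>n. z * (of_nat n * c n * z ^ (n - Suc 0))) sums (z * (\<Sum>n. diffs c n * z ^ n))"
    by (intro sums_mult diffs_equiv smd z)
  moreover have "z * (of_nat n * c n * z ^ (n - Suc 0)) = (of_nat n * c n) * z ^ n" for n
    by (cases n) auto
  ultimately have "(\<lambda>n. of_nat n * c n * z ^ n) sums (z * (\<Sum>n. diffs c n * z ^ n))" by simp
  moreover have "(\<lambda>n. of_nat n * c n * z ^ n) sums (\<Sum>\<^sub>\<infinity>n. of_nat n * c n * z ^ n)"
    by (rule has_sum_imp_sums[OF has_sum_infsum[OF so]])
  ultimately have "z * (\<Sum>n. diffs c n * z ^ n) = (\<Sum>\<^sub>\<infinity>n. of_nat n * c n * z ^ n)"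
    by (rule sums_unique2)
  with 1 show "\<exists>D. ((\<lambda>z. \<Sum>\<^sub>\<infinity>n. c n * z ^ n) has_field_derivative D) (at z) \<and>
             z * D = (\<Sum>\<^sub>\<infinity>n. of_nat n * c n * z ^ n)" by blast
qed

subsection \<open>Laurent series with explicit coefficients\<close>

definition laurent :: "(int \<Rightarrow> complex) \<Rightarrow> complex \<Rightarrow> complex" where
  "laurent a x = (\<Sum>\<^sub>\<infinity>n. a n * x powi n)"

text \<open>Where its series diverges, \<open>laurent\<close> has only a default value, so the open
  annulus of convergence is tracked separately.\<close>

definition laurent_summable :: "real \<Rightarrow> real \<Rightarrow> (int \<Rightarrow> complex) \<Rightarrow> bool" where
  "laurent_summable r R a \<longleftrightarrow>
     (\<forall>x. r < norm x \<longrightarrow> norm x < R \<longrightarrow> (\<lambda>n. a n * x powi n) summable_on UNIV)"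

lemma laurent_summableD:
  "laurent_summable r R a \<Longrightarrow> r < norm x \<Longrightarrow> norm x < R \<Longrightarrow> (\<lambda>n. a n * x powi n) summable_on UNIV"
  by (simp add: laurent_summable_def)

lemma summable_on_norm_comparison:
  fixes f g :: "'a \<Rightarrow> complex"
  assumes "g summable_on A" "\<And>x. x \<in> A \<Longrightarrow> norm (f x) \<le> norm (g x)"
  shows "f summable_on A"
  using Infinite_Sum.abs_summable_on_comparison_test[of g A f] assms
  by (simp add: summable_on_iff_abs_summable_on_complex)

text \<open>A Laurent series is a power series in \<open>x\<close> plus one in \<open>1 / x\<close>.
  On a slightly smaller annulus both lie strictly inside their discs of convergence, where the power
  series result applies.\<close>

lemma laurent_theta:
  assumes sm: "laurent_summable r R a" and r: "0 \<le> r" "r < norm x" "norm x < R"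
  shows "(\<lambda>n. of_int n * a n * x powi n) summable_on UNIV"
    and "\<exists>D. (laurent a has_field_derivative D) (at x) \<and> x * D = laurent (\<lambda>n. of_int n * a n) x"
proof -
  obtain s where s: "r < s" "s < norm x" using r dense by blast
  obtain S where S: "norm x < S" "S < R" using r dense by blast
  have s0: "s > 0" "S > 0" "x \<noteq> 0" using r s S by auto
  define c where "c = (\<lambda>n. a (int n))"
  \<comment> \<open>The constant term belongs to \<open>c\<close>; the entry 0 here keeps it from
    being counted twice.\<close>
  define d where "d = (\<lambda>n. if n = 0 then 0 else a (- int n))"
  have c: "(\<lambda>n. c n * y ^ n) summable_on UNIV" if "norm y < S" for y
  proof (rule summable_on_norm_comparison)
    have "(\<lambda>n. a n * of_real S powi n) summable_on UNIV"
      by (rule laurent_summableD[OF sm]) (use S s s0 r in auto)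
    thus "(\<lambda>n. c n * of_real S ^ n) summable_on UNIV"
      by (subst (asm) summable_on_int_iff) (auto simp: c_def)
    show "norm (c n * y ^ n) \<le> norm (c n * of_real S ^ n)" for n
      using that s0 by (auto simp: norm_mult norm_power intro!: mult_left_mono power_mono)
  qed
  have d: "(\<lambda>n. d n * y ^ n) summable_on UNIV" if "norm y < 1 / s" for y
  proof (rule summable_on_norm_comparison)
    have "(\<lambda>n. a n * of_real s powi n) summable_on UNIV"
      by (rule laurent_summableD[OF sm]) (use S s s0 r in auto)
    hence "(\<lambda>n. a (- int n) * of_real s powi (- int n)) summable_on {1..}"
      by (subst (asm) summable_on_int_iff) auto
    also have "?this \<longleftrightarrow> (\<lambda>n. d n * of_real (1 / s) ^ n) summable_on UNIV"
      by (rule summable_on_cong_neutral)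
         (auto simp: d_def power_int_minus power_one_over field_simps)
    finally show \<dots> .
    show "norm (d n * y ^ n) \<le> norm (d n * of_real (1 / s) ^ n)" for n
      unfolding norm_mult norm_power
      using that s0 by (intro mult_left_mono power_mono) (auto simp: norm_divide)
  qed
  have split: "(\<lambda>n. b n * y powi n) summable_on UNIV \<and> laurent b y = (\<Sum>\<^sub>\<infinity>n. b (int n) * y ^ n) + 
        (\<Sum>\<^sub>\<infinity>n. (if n = 0 then 0 else b (- int n)) * (1 / y) ^ n)"
    if "(\<lambda>n. b (int n) * y ^ n) summable_on UNIV"
       "(\<lambda>n. (if n = 0 then 0 else b (- int n)) * (1 / y) ^ n) summable_on UNIV" for b y
  proof -
    have iff: "((\<lambda>n. (if n = 0 then 0 else b (- int n)) * (1 / y) ^ n) has_sum t) UNIV \<longleftrightarrow>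
          ((\<lambda>n. b (- int n) * y powi (- int n)) has_sum t) {1..}" for t
      by (rule has_sum_cong_neutral)
         (auto simp: power_int_minus power_one_over divide_simps)
    have "((\<lambda>n. b n * y powi n) has_sum (\<Sum>\<^sub>\<infinity>n. b (int n) * y ^ n) + 
        (\<Sum>\<^sub>\<infinity>n. (if n = 0 then 0 else b (- int n)) * (1 / y) ^ n)) UNIV"
      using has_sum_infsum[OF that(1)] has_sum_infsum[OF that(2)] unfolding iff
      by (intro has_sum_int_split) simp_all
    thus ?thesis unfolding laurent_def
      by (auto simp: summable_on_def intro: infsumI)
  qed
  have 1: "laurent a y = (\<Sum>\<^sub>\<infinity>n. c n * y ^ n) + (\<Sum>\<^sub>\<infinity>n. d n * (1 / y) ^ n)"
    if "y \<in> ball 0 S - cball 0 s" for y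
  proof -
    have y: "norm y < S" "s < norm y" using that by auto
    hence y': "norm (1 / y) < 1 / s" using s0 by (auto simp: norm_divide intro!: divide_strict_left_mono mult_pos_pos)
    thus ?thesis using split[of a y] c[of y] d[of "1 / y"] y y' by (auto simp: c_def d_def)
  qed
  have x: "norm x < S" "norm (1 / x) < 1 / s" using s S s0 by (auto simp: norm_divide field_simps)
  note C = power_series_theta[OF c x(1)] and D = power_series_theta[OF d x(2)]
  have D1: "(\<lambda>n. (if n = 0 then 0 else of_int (- int n) * a (- int n)) * (1 / x) ^ n) summable_on UNIV"
    and D2: "(\<Sum>\<^sub>\<infinity>n. (if n = 0 then 0 else of_int (- int n) * a (- int n)) * (1 / x) ^ n) = 
          - (\<Sum>\<^sub>\<infinity>n. of_nat n * d n * (1 / x) ^ n)"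
  proof -
    have "(\<lambda>n. (if n = 0 then 0 else of_int (- int n) * a (- int n)) * (1 / x) ^ n) = 
          (\<lambda>n. - (of_nat n * d n * (1 / x) ^ n))" by (auto simp: d_def)
    thus "(\<lambda>n. (if n = 0 then 0 else of_int (- int n) * a (- int n)) * (1 / x) ^ n) summable_on UNIV"
       "(\<Sum>\<^sub>\<infinity>n. (if n = 0 then 0 else of_int (- int n) * a (- int n)) * (1 / x) ^ n) = 
          - (\<Sum>\<^sub>\<infinity>n. of_nat n * d n * (1 / x) ^ n)"
      using D(1) by (simp_all only: summable_on_uminus infsum_uminus)
  qed
  have C1: "(\<lambda>n. of_int (int n) * a (int n) * x ^ n) summable_on UNIV"
    using C(1) by (simp add: c_def)
  note sp = split[of "\<lambda>n. of_int n * a n" x, OF C1 D1]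
  show "(\<lambda>n. of_int n * a n * x powi n) summable_on UNIV" using sp by blast
  obtain D1 where D1: "((\<lambda>z. \<Sum>\<^sub>\<infinity>n. c n * z ^ n) has_field_derivative D1) (at x)"
    "x * D1 = (\<Sum>\<^sub>\<infinity>n. of_nat n * c n * x ^ n)" using C(2) by blast
  obtain D2 where D2': "((\<lambda>z. \<Sum>\<^sub>\<infinity>n. d n * z ^ n) has_field_derivative D2) (at (1 / x))"
    "1 / x * D2 = (\<Sum>\<^sub>\<infinity>n. of_nat n * d n * (1 / x) ^ n)" using D(2) by blast
  \<comment> \<open>Under the inversion the Euler operator changes sign, which is what the
    coefficients of negative index require.\<close>
  have "((\<lambda>y. 1 / y) has_field_derivative - 1 / x ^ 2) (at x)"
    using s0 by (auto intro!: derivative_eq_intros simp: power2_eq_square field_simps)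
  from DERIV_chain'[OF this D2'(1)]
  have "((\<lambda>y. (\<Sum>\<^sub>\<infinity>n. c n * y ^ n) + (\<Sum>\<^sub>\<infinity>n. d n * (1 / y) ^ n)) has_field_derivative
          D1 + D2 * (- 1 / x ^ 2)) (at x)"
    by (intro DERIV_add D1) 
  hence "(laurent a has_field_derivative D1 + D2 * (- 1 / x ^ 2)) (at x)"
    by (rule has_field_derivative_transform_within_open[where S = "ball 0 S - cball 0 s"])
       (use 1 s S in \<open>auto intro: open_Diff\<close>)
  moreover have "x * (D1 + D2 * (- 1 / x ^ 2)) = laurent (\<lambda>n. of_int n * a n) x"
  proof -
    have "x * (D1 + D2 * (- 1 / x ^ 2)) = x * D1 - 1 / x * D2"
      using s0 by (simp add: field_simps power2_eq_square)
    also have "\<dots> = laurent (\<lambda>n. of_int n * a n) x"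
      unfolding sp[THEN conjunct2] D2 D1(2) D2'(2) by (simp add: c_def)
    finally show ?thesis .
  qed
  ultimately show "\<exists>D. (laurent a has_field_derivative D) (at x) \<and> x * D = laurent (\<lambda>n. of_int n * a n) x"
    by blast
qed

lemma laurent_summable_theta:
  "laurent_summable r R a \<Longrightarrow> 0 \<le> r \<Longrightarrow> laurent_summable r R (\<lambda>n. of_int n * a n)"
  using laurent_theta(1) unfolding laurent_summable_def by blast

lemma laurent_summable_theta_power:
  assumes "laurent_summable r R a" "0 \<le> r"
  shows "laurent_summable r R (\<lambda>n. of_int n ^ j * a n)"
proof (induction j)
  case (Suc j)
  from laurent_summable_theta[OF this assms(2)] show ?case by (simp add: mult.assoc)
qed (use assms in simp)

text \<open>Substituting \<open>c * exp t\<close> turns x d/dx into d/dt, so all derivatives stay in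
  the family with coefficients n^j a_n. The constant \<open>c\<close> is 1 or -1 in the
  applications.\<close>

lemma has_field_derivative_laurent_exp:
  assumes "laurent_summable r R a" "0 \<le> r" "r < norm (c * exp t)" "norm (c * exp t) < R"
  shows "((\<lambda>t. laurent (\<lambda>n. of_int n ^ j * a n) (c * exp t)) has_field_derivative
           laurent (\<lambda>n. of_int n ^ Suc j * a n) (c * exp t)) (at t)"
proof -
  obtain D where D: "(laurent (\<lambda>n. of_int n ^ j * a n) has_field_derivative D) (at (c * exp t))"
    "c * exp t * D = laurent (\<lambda>n. of_int n * (of_int n ^ j * a n)) (c * exp t)"
    using laurent_theta(2)[OF laurent_summable_theta_power[OF assms(1,2), of j] assms(2), of "c * exp t"] assms(3,4)
    by auto
  have "((\<lambda>t. c * exp t) has_field_derivative c * exp t) (at t)"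
    by (auto intro!: derivative_eq_intros)
  from DERIV_chain'[OF this D(1)] D(2) show ?thesis by (simp add: mult_ac)
qed

text \<open>The powers of \<open>x\<close> in the convolution combine to a common factor x^n.
  Dividing by it shows that the coefficient sums converge by themselves, with no reference to
  \<open>x\<close>.\<close>

lemma laurent_mult:
  assumes "(\<lambda>n. a n * x powi n) summable_on UNIV" "(\<lambda>n. b n * x powi n) summable_on UNIV" "x \<noteq> 0"
  shows "((\<lambda>n. (\<Sum>\<^sub>\<infinity>k. a k * b (n - k)) * x powi n) has_sum laurent a x * laurent b x) UNIV"
    and "(\<lambda>k. a k * b (n - k)) summable_on UNIV"
proof -
  have eq: "a k * x powi k * (b (n - k) * x powi (n - k)) = a k * b (n - k) * x powi n" for k n
    using assms(3) by (simp add: power_int_diff)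
  note * = has_sum_convolution[OF has_sum_infsum[OF assms(1)] has_sum_infsum[OF assms(2)], unfolded eq]
  show "(\<lambda>k. a k * b (n - k)) summable_on UNIV"
    using summable_on_cmult_left[OF *(2)[of n], of "x powi (-n)"] assms(3)
    by (simp add: mult.assoc power_int_minus)
  have "(\<Sum>\<^sub>\<infinity>k. a k * b (n - k) * x powi n) = (\<Sum>\<^sub>\<infinity>k. a k * b (n - k)) * x powi n" for n
    by (rule infsum_cmult_left')
  with *(1) show "((\<lambda>n. (\<Sum>\<^sub>\<infinity>k. a k * b (n - k)) * x powi n) has_sum laurent a x * laurent b x) UNIV"
    by (simp add: laurent_def)
qed

subsection \<open>The Laurent coefficients of the elliptic functions\<close>

lemma has_sum_minus:
  fixes f g :: "'a \<Rightarrow> complex"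
  assumes "(f has_sum s) A" "(g has_sum t) A"
  shows "((\<lambda>x. f x - g x) has_sum s - t) A"
  using has_sum_add[OF assms(1), of "\<lambda>x. - g x" "- t"] assms(2) by (simp add: has_sum_uminus)

text \<open>The two halves are dominated by geometric series of ratio \<open>r * norm x\<close> and
  \<open>r / norm x\<close>; both ratios are below 1 exactly on this annulus.\<close>

lemma laurent_summable_geometric_bound:
  fixes a :: "int \<Rightarrow> complex"
  assumes "0 < r" "\<And>n. norm (a n) \<le> C * r powi \<bar>n\<bar>"
  shows "laurent_summable r (1 / r) a"
  unfolding laurent_summable_def
proof (intro allI impI)
  fix x :: complex
  assume x: "r < norm x" "norm x < 1 / r"
  have geo: "(\<lambda>n. C * y ^ n) summable_on UNIV" if "0 \<le> y" "y < 1" for y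
    by (intro summable_on_cmult_right norm_summable_imp_summable_on)
       (use that in \<open>simp add: norm_power summable_geometric\<close>)
  have "(\<lambda>n. norm (a n * x powi n)) summable_on UNIV"
    unfolding summable_on_int_iff
  proof
    show "(\<lambda>n. norm (a (int n) * x powi int n)) summable_on UNIV"
    proof (rule Infinite_Sum.abs_summable_on_comparison_test'[OF geo[of "r * norm x"]])
      show "r * norm x < 1" using x assms by (simp add: field_simps)
      show "norm (a (int n) * x powi int n) \<le> C * (r * norm x) ^ n" for n
        using mult_right_mono[OF assms(2)[of "int n"], of "norm x ^ n"]
        by (simp add: norm_mult norm_power power_mult_distrib mult_ac)
    qed (use assms in auto)
    have "(\<lambda>n. norm (a (- int n) * x powi (- int n))) summable_on UNIV"
    proof (rule Infinite_Sum.abs_summable_on_comparison_test'[OF geo[of "r / norm x"]])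
      show "r / norm x < 1" using x assms(1) order.strict_trans[OF assms(1) x(1)] by (simp add: field_simps)
      show "norm (a (- int n) * x powi (- int n)) \<le> C * (r / norm x) ^ n" for n
        using mult_right_mono[OF assms(2)[of "- int n"], of "norm x powi (- int n)"]
        by (simp add: norm_mult norm_power norm_power_int norm_inverse power_mult_distrib power_inverse power_int_minus divide_inverse mult_ac)
    qed (use assms in auto)
    thus "(\<lambda>n. norm (a (- int n) * x powi (- int n))) summable_on {1..}"
      by (rule summable_on_subset_banach) auto
  qed
  thus "(\<lambda>n. a n * x powi n) summable_on UNIV" by (rule abs_summable_summable)
qed

text \<open>The value 1/2 at 0 makes the remainders \<open>f_reg\<close> and \<open>g_reg\<close> below odd.\<close>

definition half_step :: "int \<Rightarrow> complex" where
  "half_step n = (if n > 0 then 1 else if n = 0 then 1 / 2 else 0)"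

text \<open>This rational function carries the whole obstruction to convergence of \<Phi> on the
  unit circle; at \<open>x = - exp t\<close> it continues through \<open>t = 0\<close>.\<close>

lemma has_sum_half_step:
  assumes "norm x < 1"
  shows "((\<lambda>n. half_step n * x powi n) has_sum 1 / (1 - x) - 1 / 2) UNIV"
proof -
  have "((\<lambda>n. x ^ n) has_sum 1 / (1 - x)) UNIV"
    by (rule norm_summable_imp_has_sum)
       (use assms geometric_sums[of x] in \<open>auto simp: norm_power summable_geometric\<close>)
  moreover have "((\<lambda>n::nat. if n = 0 then - 1 / 2 else 0) has_sum (- 1 / 2 :: complex)) UNIV"
    by (rule has_sum_finite_neutralI[of "{0}"]) auto
  ultimately have "((\<lambda>n. x ^ n + (if n = 0 then - 1 / 2 else 0)) has_sum (1 / (1 - x) + (- 1 / 2))) UNIV"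
    by (rule has_sum_add)
  also have "(\<lambda>n. x ^ n + (if n = 0 then - 1 / 2 else 0)) = (\<lambda>n. half_step (int n) * x powi int n)"
    by (auto simp: half_step_def fun_eq_iff)
  finally have 1: "((\<lambda>n. half_step (int n) * x powi int n) has_sum (1 / (1 - x) + (- 1 / 2))) UNIV" .
  have 2: "((\<lambda>n. half_step (- int n) * x powi (- int n)) has_sum 0) {1..}"
    by (rule has_sum_0) (auto simp: half_step_def)
  show ?thesis using has_sum_int_split[OF 1 2] by simp
qed

lemma laurent_summable_half_step: "0 \<le> r \<Longrightarrow> laurent_summable r 1 half_step"
  using has_sum_half_step unfolding laurent_summable_def summable_on_def by blast

section \<open>The coefficients \<open>f\<close> and \<open>g\<close> and their regular
  parts\<close>

locale nome =
  fixes q :: complex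
  assumes q: "0 < norm q" "norm q < 1"
begin

definition f :: "int \<Rightarrow> complex" where "f n = 1 / (1 + q powi n)"

text \<open>The value 1/2 replaces the pole at 0 and keeps the symmetry
  \<open>g (- n) = 1 - g n\<close> valid there.\<close>

definition g :: "int \<Rightarrow> complex" where "g n = (if n = 0 then 1 / 2 else 1 / (1 - q powi n))"

definition f_reg :: "int \<Rightarrow> complex" where "f_reg n = f n - half_step n"

definition g_reg :: "int \<Rightarrow> complex" where "g_reg n = g n - half_step n"

lemma q_nz: "q \<noteq> 0" using q by auto

lemma powi_norm_less: "n > 0 \<Longrightarrow> norm (q powi n) \<le> norm q"
  using q power_decreasing[of 1 "nat n" "norm q"] by (simp add: norm_power power_int_def)

lemma one_minus_powi_nz: "n \<noteq> 0 \<Longrightarrow> 1 - q powi n \<noteq> 0" and one_plus_powi_nz: "1 + q powi n \<noteq> 0"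
proof -
  have *: "norm (q powi n) \<noteq> 1" if n: "n \<noteq> 0" for n
  proof (cases "n > 0")
    case True
    thus ?thesis using powi_norm_less[of n] q by auto
  next
    case False
    hence "norm (q powi (- n)) \<le> norm q" using powi_norm_less[of "- n"] n by auto
    hence "inverse (norm (q powi n)) \<le> norm q"
      by (simp add: power_int_minus norm_inverse)
    thus ?thesis using q by auto
  qed
  show "1 - q powi n \<noteq> 0" if "n \<noteq> 0" using *[OF that] by (metis norm_one right_minus_eq)
  show "1 + q powi n \<noteq> 0"
  proof (cases "n = 0")
    case False
    have "q powi n \<noteq> - 1" using *[OF False] by auto
    thus ?thesis by (metis add.inverse_inverse add_eq_0_iff)
  qed auto
qed

lemma f_minus: "f (- n) = 1 - f n"
  using one_plus_powi_nz[of n] q_nz by (simp add: f_def power_int_minus field_simps)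

lemma g_minus: "g (- n) = 1 - g n"
proof (cases "n = 0")
  case False
  define z where "z = q powi n"
  have "z \<noteq> 1" "z \<noteq> 0" using one_minus_powi_nz[OF False] q_nz by (auto simp: z_def)
  hence "1 / (1 - inverse z) = 1 - 1 / (1 - z)" by (simp add: divide_simps) (simp add: algebra_simps)
  thus ?thesis using False by (simp add: g_def power_int_minus z_def)
qed (simp add: g_def)

lemma half_step_minus: "half_step (- n) = 1 - half_step n"
  by (simp add: half_step_def)

lemma f_reg_minus: "f_reg (- n) = - f_reg n" and g_reg_minus: "g_reg (- n) = - g_reg n"
  by (simp_all add: f_reg_def g_reg_def f_minus g_minus half_step_minus)

lemma f_reg_pos: "n > 0 \<Longrightarrow> f_reg n = - (q powi n / (1 + q powi n))"
  using one_plus_powi_nz[of n] by (simp add: f_reg_def f_def half_step_def field_simps)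

lemma g_reg_pos: "n > 0 \<Longrightarrow> g_reg n = q powi n / (1 - q powi n)"
  using one_minus_powi_nz[of n] by (simp add: g_reg_def g_def half_step_def field_simps)

lemma laurent_summable_odd:
  assumes "\<And>n. a (- n) = - a n" "\<And>n. n > 0 \<Longrightarrow> norm (a n) \<le> norm (q powi n) / (1 - norm q)"
  shows "laurent_summable (norm q) (1 / norm q) a"
proof (rule laurent_summable_geometric_bound[where C = "1 / (1 - norm q)"])
  show "norm (a n) \<le> 1 / (1 - norm q) * norm q powi \<bar>n\<bar>" for n
  proof (cases n "0 :: int" rule: linorder_cases)
    case less
    thus ?thesis using assms(2)[of "- n"] assms(1)[of n] by (simp add: norm_power_int)
  next
    case equal
    have "a 0 = 0" using assms(1)[of 0] by simp
    thus ?thesis using equal q by simp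
  qed (use assms(2)[of n] in \<open>simp add: norm_power_int\<close>)
qed (use q in auto)

lemma laurent_summable_f_reg: "laurent_summable (norm q) (1 / norm q) f_reg"
  and laurent_summable_g_reg: "laurent_summable (norm q) (1 / norm q) g_reg"
proof -
  have *: "norm (1 + q powi n) \<ge> 1 - norm q" "norm (1 - q powi n) \<ge> 1 - norm q" if "n > 0" for n
    using powi_norm_less[OF that] norm_diff_ineq[of 1 "q powi n"] norm_triangle_ineq2[of 1 "q powi n"]
    by auto
  show "laurent_summable (norm q) (1 / norm q) f_reg"
    by (rule laurent_summable_odd)
       (use * q in \<open>auto simp: f_reg_minus f_reg_pos norm_divide intro!: divide_left_mono mult_pos_pos simp: one_plus_powi_nz one_minus_powi_nz\<close>)
  show "laurent_summable (norm q) (1 / norm q) g_reg"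
    by (rule laurent_summable_odd)
       (use * q in \<open>auto simp: g_reg_minus g_reg_pos norm_divide one_minus_powi_nz[simplified] intro!: divide_left_mono mult_pos_pos\<close>)
qed

lemma laurent_summable_add_half_step:
  assumes "laurent_summable (norm q) (1 / norm q) a"
  shows "laurent_summable (norm q) 1 (\<lambda>n. a n + half_step n)"
  unfolding laurent_summable_def
proof (intro allI impI)
  fix x :: complex assume x: "norm q < norm x" "norm x < 1"
  moreover have "1 < 1 / norm q" using q by simp
  ultimately have "norm x < 1 / norm q" by linarith
  with x show "(\<lambda>n. (a n + half_step n) * x powi n) summable_on UNIV"
    unfolding distrib_right
    by (intro summable_on_add laurent_summableD[OF assms] laurent_summableD[OF laurent_summable_half_step[of "norm q"]]) auto
qed

lemma laurent_summable_f: "laurent_summable (norm q) 1 f"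
  and laurent_summable_g: "laurent_summable (norm q) 1 g"
  using laurent_summable_add_half_step[OF laurent_summable_f_reg]
        laurent_summable_add_half_step[OF laurent_summable_g_reg]
  by (simp_all add: f_reg_def g_reg_def)

lemma one_in_annulus: "norm q < norm (1::complex)" "norm (1::complex) < 1 / norm q"
  using q by simp_all

text \<open>Differences of \<open>f_reg\<close> telescope to 0, in the first moment too because
  \<open>f_reg\<close> is odd and has sum 0. Only the jumps of \<open>half_step\<close> remain: 1/2
  at m = 0 and 1/2 at m = 1, with total 1 and first moment 1/2.\<close>

lemma has_sum_f_diff: "((\<lambda>m. f m - f (m - 1)) has_sum 1) UNIV"
  and has_sum_int_f_diff: "((\<lambda>m. of_int m * (f m - f (m - 1))) has_sum 1 / 2) UNIV"
proof -
  have reindex: "((\<lambda>m. h (m - 1)) has_sum s) UNIV \<longleftrightarrow> (h has_sum s) UNIV" for h :: "int \<Rightarrow> complex" and s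
    by (rule has_sum_reindex_bij_witness[of _ "\<lambda>m. m + 1" "\<lambda>m. m - 1"]) auto
  have "f_reg summable_on UNIV"
    using laurent_summableD[OF laurent_summable_f_reg one_in_annulus] by simp
  then obtain s where s: "(f_reg has_sum s) UNIV" by (auto simp: summable_on_def)
  have "((\<lambda>n. f_reg (- n)) has_sum s) UNIV"
    by (subst has_sum_reindex_bij_witness[of _ uminus uminus UNIV f_reg _ _ s]) (use s in auto)
  hence "(f_reg has_sum - s) UNIV" by (simp add: f_reg_minus has_sum_uminus)
  hence "s = 0" using s has_sum_unique by fastforce
  with s have s0: "(f_reg has_sum 0) UNIV" by simp
  obtain t where t: "((\<lambda>m. of_int m * f_reg m) has_sum t) UNIV"
    using laurent_summableD[OF laurent_summable_theta[OF laurent_summable_f_reg] one_in_annulus]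
    by (auto simp: summable_on_def)
  have 1: "((\<lambda>m. half_step m - half_step (m - 1)) has_sum 1) UNIV"
    by (rule has_sum_finite_neutralI[of "{0, 1}"]) (auto simp: half_step_def)
  have 2: "((\<lambda>m. of_int m * (half_step m - half_step (m - 1))) has_sum 1 / 2) UNIV"
    by (rule has_sum_finite_neutralI[of "{0, 1}"]) (auto simp: half_step_def)
  from has_sum_add[OF has_sum_minus[OF s0 reindex[THEN iffD2, OF s0]] 1]
  show "((\<lambda>m. f m - f (m - 1)) has_sum 1) UNIV" by (simp add: f_reg_def)
  from has_sum_add[OF has_sum_minus[OF has_sum_minus[OF t reindex[THEN iffD2, OF t]] 
           reindex[THEN iffD2, OF s0]] 2]
  show "((\<lambda>m. of_int m * (f m - f (m - 1))) has_sum 1 / 2) UNIV"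
    by (simp add: f_reg_def algebra_simps)
qed

end

subsection \<open>Square and cube of the elliptic function\<close>

context nome begin

text \<open>Coefficient convolutions are shown to converge through \<open>laurent_mult\<close>,
  which needs some point of common convergence.\<close>

lemma ex_annulus: "\<exists>x :: complex. norm q < norm x \<and> norm x < 1"
proof -
  obtain r where "norm q < r" "r < 1" using q dense by blast
  moreover have "r > 0" using q(1) \<open>norm q < r\<close> by linarith
  ultimately show ?thesis by (intro exI[of _ "of_real r"]) auto
qed

definition S :: complex where "S = (\<Sum>\<^sub>\<infinity>k. f k * f (- k))"

text \<open>These turn out to be the Laurent coefficients of \<Phi>^2. The first term vanishes at 0,
  leaving \<open>S\<close> as the constant coefficient.\<close>

definition sq_coeff :: "int \<Rightarrow> complex" where "sq_coeff n = of_int n * g n + (if n = 0 then S else 0)"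

lemma f_convolution_f_summable: "(\<lambda>k. f k * f (n - k)) summable_on UNIV"
  using ex_annulus laurent_mult(2)[of f _ f n] laurent_summableD[OF laurent_summable_f] q_nz by force

text \<open>A shift by \<open>n\<close> consists of \<open>n\<close> unit shifts, each contributing
  the total jump 1 of \<open>f\<close>.\<close>

lemma has_sum_f_diff_shift: "((\<lambda>k. f (n - k) - f (- k)) has_sum of_int n) UNIV"
proof -
  have step: "((\<lambda>k. f (n + 1 - k) - f (n - k)) has_sum 1) UNIV" for n
    by (subst has_sum_reindex_bij_witness[of _ "\<lambda>m. n + 1 - m" "\<lambda>k. n + 1 - k" UNIV
          "\<lambda>m. f m - f (m - 1)" _ _ 1]) (use has_sum_f_diff in auto)
  show ?thesis
  proof (induction n rule: int_induct[where k = 0])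
    case (step1 i)
    from has_sum_add[OF this(2) step[of i]] show ?case by (simp add: add.commute)
  next
    case (step2 i)
    from has_sum_minus[OF this(2) step[of "i - 1"]] show ?case by simp
  qed simp
qed

text \<open>
  Since \<open>1 - q\<^sup>n = (1 + q\<^sup>k) - q\<^sup>k (1 + q\<^bsup>n - k\<^esup>)\<close>, multiplying the convolution by \<open>1 - q\<^sup>n\<close> makes it telescope.
\<close>

lemma f_convolution_f: "(\<Sum>\<^sub>\<infinity>k. f k * f (n - k)) = sq_coeff n"
proof (cases "n = 0")
  case False
  have "(1 - q powi n) * (f k * f (n - k)) = f (n - k) - f (- k)" for k
  proof -
    define a b where "a = q powi k" and "b = q powi (n - k)"
    have ab: "1 + a \<noteq> 0" "1 + b \<noteq> 0" using one_plus_powi_nz by (auto simp: a_def b_def)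
    have ab': "q powi n = a * b" using q_nz by (simp add: a_def b_def flip: power_int_add)
    have "f k = 1 / (1 + a)" "f (- k) = 1 - 1 / (1 + a)" "f (n - k) = 1 / (1 + b)"
      unfolding f_minus by (simp_all add: f_def a_def b_def)
    moreover have "(1 - a * b) * (1 / (1 + a) * (1 / (1 + b))) = 1 / (1 + b) - (1 - 1 / (1 + a))"
      using ab by (simp add: divide_simps) (simp add: algebra_simps)
    ultimately show ?thesis unfolding ab' by simp
  qed
  hence "((\<lambda>k. (1 - q powi n) * (f k * f (n - k))) has_sum of_int n) UNIV"
    using has_sum_f_diff_shift[of n] by simp
  moreover have "((\<lambda>k. (1 - q powi n) * (f k * f (n - k))) has_sum
      (1 - q powi n) * (\<Sum>\<^sub>\<infinity>k. f k * f (n - k))) UNIV"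
    by (intro has_sum_cmult_right has_sum_infsum f_convolution_f_summable)
  ultimately have "(1 - q powi n) * (\<Sum>\<^sub>\<infinity>k. f k * f (n - k)) = of_int n"
    using has_sum_unique by blast
  thus ?thesis using one_minus_powi_nz[OF False] False by (simp add: sq_coeff_def g_def field_simps)
qed (simp add: S_def sq_coeff_def)

lemma summable_f: "norm q < norm x \<Longrightarrow> norm x < 1 \<Longrightarrow> (\<lambda>n. f n * x powi n) summable_on UNIV"
  by (rule laurent_summableD[OF laurent_summable_f])

lemma
  assumes "norm q < norm x" "norm x < 1"
  shows has_sum_laurent_f_square: "((\<lambda>n. sq_coeff n * x powi n) has_sum laurent f x ^ 2) UNIV"
    and laurent_f_square: "laurent f x ^ 2 = S + laurent (\<lambda>n. of_int n * g n) x"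
proof -
  have "x \<noteq> 0" using assms q by auto
  from laurent_mult(1)[OF summable_f[OF assms] summable_f[OF assms] this]
  show *: "((\<lambda>n. sq_coeff n * x powi n) has_sum laurent f x ^ 2) UNIV"
    by (simp add: f_convolution_f power2_eq_square)
  have "((\<lambda>n. of_int n * g n * x powi n) has_sum laurent (\<lambda>n. of_int n * g n) x) UNIV"
    unfolding laurent_def
    by (intro has_sum_infsum laurent_summableD[OF laurent_summable_theta[OF laurent_summable_g]] assms) simp
  moreover have "((\<lambda>n. if n = 0 then S else 0) has_sum S) (UNIV :: int set)"
    by (rule has_sum_finite_neutralI[of "{0}"]) auto
  ultimately have "((\<lambda>n. of_int n * g n * x powi n + (if n = 0 then S else 0)) has_sum
      laurent (\<lambda>n. of_int n * g n) x + S) UNIV"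
    by (rule has_sum_add)
  also have "(\<lambda>n. of_int n * g n * x powi n + (if n = 0 then S else 0)) = (\<lambda>n. sq_coeff n * x powi n)"
    by (auto simp: sq_coeff_def)
  finally show "laurent f x ^ 2 = S + laurent (\<lambda>n. of_int n * g n) x"
    using has_sum_unique[OF *] by (simp add: add.commute)
qed

text \<open>Normalised so that the constant coefficient of \<Phi>^3 is \<open>f 0 * E\<close>, since
  \<open>f 0\<close> is 1/2.\<close>

definition E :: complex where "E = 2 * (\<Sum>\<^sub>\<infinity>k. sq_coeff k * f (- k))"

lemma sq_coeff_convolution_f_summable: "(\<lambda>k. sq_coeff k * f (n - k)) summable_on UNIV"
proof -
  obtain x :: complex where x: "norm q < norm x" "norm x < 1" using ex_annulus by blast
  have "x \<noteq> 0" using x q by auto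
  moreover have "(\<lambda>n. sq_coeff n * x powi n) summable_on UNIV"
    using has_sum_laurent_f_square[OF x] by (auto simp: summable_on_def)
  ultimately show ?thesis using laurent_mult(2) summable_f[OF x] by blast
qed

text \<open>
  Here \<open>1 + q\<^sup>n = (1 - q\<^sup>k) + q\<^sup>k (1 + q\<^bsup>n - k\<^esup>)\<close>.  The two resulting sums diverge separately, so only
  the differences in \<open>n\<close> are evaluated.
\<close>

lemma sq_coeff_convolution_f: "(\<Sum>\<^sub>\<infinity>k. sq_coeff k * f (n - k)) = f n * (E + of_int n ^ 2 / 2)"
proof -
  define r where "r n = (\<Sum>\<^sub>\<infinity>k. sq_coeff k * f (n - k))" for n
  have r: "((\<lambda>k. sq_coeff k * f (n - k)) has_sum r n) UNIV" for n
    unfolding r_def by (rule has_sum_infsum[OF sq_coeff_convolution_f_summable])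
  have step: "(1 + q powi n) * r n - (1 + q powi (n - 1)) * r (n - 1) = of_int n - 1 / 2" for n
  proof -
    have "((\<lambda>k. (1 + q powi n) * (sq_coeff k * f (n - k)) - 
            (1 + q powi (n - 1)) * (sq_coeff k * f (n - 1 - k))) has_sum
          ((1 + q powi n) * r n - (1 + q powi (n - 1)) * r (n - 1))) UNIV"
      by (intro has_sum_minus has_sum_cmult_right r)
    also have "(\<lambda>k. (1 + q powi n) * (sq_coeff k * f (n - k)) - 
            (1 + q powi (n - 1)) * (sq_coeff k * f (n - 1 - k))) =
          (\<lambda>k. of_int k * (f (n - k) - f (n - 1 - k)))"
    proof
      fix k
      have *: "(1 + q powi m) * f (m - k) = (1 - q powi k) * f (m - k) + q powi k" for m
      proof -
        have "q powi m = q powi k * q powi (m - k)" using q_nz by (simp flip: power_int_add)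
        thus ?thesis using one_plus_powi_nz[of "m - k"] by (simp add: f_def field_simps)
      qed
      \<comment> \<open>Both sides vanish at \<open>k = 0\<close>, which is how the constant
        \<open>S\<close> disappears.\<close>
      have "(1 - q powi k) * sq_coeff k = of_int k"
        using one_minus_powi_nz[of k] by (simp add: sq_coeff_def g_def)
      moreover have "(1 + q powi n) * (sq_coeff k * f (n - k)) - 
            (1 + q powi (n - 1)) * (sq_coeff k * f (n - 1 - k)) =
            sq_coeff k * ((1 + q powi n) * f (n - k) - (1 + q powi (n - 1)) * f (n - 1 - k))"
        by (simp add: algebra_simps)
      moreover have "\<dots> = (1 - q powi k) * sq_coeff k * (f (n - k) - f (n - 1 - k))"
        unfolding * by (simp add: algebra_simps)
      ultimately show "(1 + q powi n) * (sq_coeff k * f (n - k)) - 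
            (1 + q powi (n - 1)) * (sq_coeff k * f (n - 1 - k)) = of_int k * (f (n - k) - f (n - 1 - k))"
        by simp
    qed
    \<comment> \<open>With \<open>m = n - k\<close> the sum is a combination of the two moments
      computed in \<open>has_sum_f_diff\<close> and \<open>has_sum_int_f_diff\<close>.\<close>
    also have "((\<lambda>k. of_int k * (f (n - k) - f (n - 1 - k))) has_sum s) UNIV \<longleftrightarrow>
        ((\<lambda>m. of_int (n - m) * (f m - f (m - 1))) has_sum s) UNIV" for s
      by (rule has_sum_reindex_bij_witness[of _ "\<lambda>m. n - m" "\<lambda>k. n - k"]) (auto simp: algebra_simps)
    finally have 1: "((\<lambda>m. of_int (n - m) * (f m - f (m - 1))) has_sum
          ((1 + q powi n) * r n - (1 + q powi (n - 1)) * r (n - 1))) UNIV" .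
    have "((\<lambda>m. of_int n * (f m - f (m - 1)) - of_int m * (f m - f (m - 1))) has_sum
          of_int n * 1 - 1 / 2) UNIV"
      by (intro has_sum_minus has_sum_cmult_right has_sum_f_diff has_sum_int_f_diff)
    hence "((\<lambda>m. of_int (n - m) * (f m - f (m - 1))) has_sum of_int n - 1 / 2) UNIV"
      by (simp add: algebra_simps)
    with 1 show ?thesis by (rule has_sum_unique)
  qed
  \<comment> \<open>At \<open>n = 0\<close> the factor 2 produces \<open>E\<close>; each increment
    \<open>n - 1 / 2\<close> equals (n^2 - (n - 1)^2) / 2.\<close>
  have "(1 + q powi n) * r n = E + of_int n ^ 2 / 2"
  proof (induction n rule: int_induct[where k = 0])
    case base
    show ?case by (simp add: r_def E_def)
  next
    case (step1 i)
    thus ?case using step[of "i + 1"] by (simp add: power2_eq_square field_simps)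
  next
    case (step2 i)
    thus ?case using step[of i] by (simp add: power2_eq_square field_simps)
  qed
  hence "r n = (E + of_int n ^ 2 / 2) / (1 + q powi n)"
    using one_plus_powi_nz[of n] by (simp add: eq_divide_eq mult.commute)
  thus ?thesis by (simp add: r_def f_def)
qed

text \<open>In the variable t with \<open>x = - exp t\<close>, the factor n^2 is a second
  derivative, so this is the differential equation \<Phi>'' = 2 \<Phi>^3 - 2 E \<Phi>.\<close>

lemma laurent_f_cube:
  assumes "norm q < norm x" "norm x < 1"
  shows "laurent f x ^ 3 = E * laurent f x + laurent (\<lambda>n. of_int n ^ 2 * f n) x / 2"
proof -
  have x: "x \<noteq> 0" using assms q by auto
  note sq = has_sum_laurent_f_square[OF assms]
  have "((\<lambda>n. f n * (E + of_int n ^ 2 / 2) * x powi n) has_sum laurent sq_coeff x * laurent f x) UNIV"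
    using laurent_mult(1)[OF _ summable_f[OF assms] x, of sq_coeff] sq
    unfolding sq_coeff_convolution_f by (auto simp: summable_on_def)
  moreover have "laurent sq_coeff x = laurent f x ^ 2"
    using sq by (simp add: laurent_def infsumI)
  moreover have "((\<lambda>n. E * (f n * x powi n) + of_int n ^ 2 * f n * x powi n * (1 / 2)) has_sum
       E * laurent f x + laurent (\<lambda>n. of_int n ^ 2 * f n) x * (1 / 2)) UNIV"
    unfolding laurent_def
    by (intro has_sum_add has_sum_cmult_right has_sum_cmult_left has_sum_infsum summable_f assms 
              laurent_summableD[OF laurent_summable_theta_power[OF laurent_summable_f]]) simp
  moreover have "(\<lambda>n. E * (f n * x powi n) + of_int n ^ 2 * f n * x powi n * (1 / 2)) =
      (\<lambda>n. f n * (E + of_int n ^ 2 / 2) * x powi n)"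
    by (simp add: field_simps)
  ultimately show ?thesis
    using has_sum_unique by (fastforce simp: power3_eq_cube power2_eq_square)
qed

end

subsection \<open>Taylor coefficients at the origin\<close>

text \<open>
  With \<open>s = 1 / (1 + exp t)\<close> one has \<open>ds/dt = s\<^sup>2 - s\<close>, so every derivative of \<open>s - 1/2\<close> is a polynomial in \<open>s\<close>.
\<close>

primrec logistic_poly :: "nat \<Rightarrow> complex poly" where
  "logistic_poly 0 = [:- 1 / 2, 1:]"
| "logistic_poly (Suc j) = pderiv (logistic_poly j) * [:0, - 1, 1:]"

lemma has_field_derivative_logistic_poly:
  assumes "exp t \<noteq> - 1"
  shows "((\<lambda>t. poly (logistic_poly j) (1 / (1 + exp t))) has_field_derivative
           poly (logistic_poly (Suc j)) (1 / (1 + exp t))) (at t)"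
proof -
  have nz: "1 + exp t \<noteq> 0" using assms by (metis add_eq_0_iff)
  have "((\<lambda>t. 1 / (1 + exp t)) has_field_derivative - exp t / (1 + exp t) ^ 2) (at t)"
    using nz by (auto intro!: derivative_eq_intros simp: power2_eq_square)
  from DERIV_chain'[OF this poly_DERIV[of "logistic_poly j"]]
  have "((\<lambda>t. poly (logistic_poly j) (1 / (1 + exp t))) has_field_derivative
     poly (pderiv (logistic_poly j)) (1 / (1 + exp t)) * (- exp t / (1 + exp t) ^ 2)) (at t)" .
  also have "- exp t / (1 + exp t) ^ 2 = poly [:0, - 1, 1:] (1 / (1 + exp t))"
    using nz by (simp add: divide_simps power2_eq_square)
  finally show ?thesis by (simp only: logistic_poly.simps poly_mult)
qed

lemma deriv_unique_on_open:
  fixes u :: "complex \<Rightarrow> complex"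
  assumes "open T" "t \<in> T" "\<And>t. t \<in> T \<Longrightarrow> u t = v t"
    and "(u has_field_derivative u') (at t)" "(v has_field_derivative v') (at t)"
  shows "u' = v'"
  using has_field_derivative_transform_within_open[OF assms(4,1,2)] assms(3,5) DERIV_unique by blast

context nome
begin

text \<open>
  \<open>W a j\<close> is the \<open>j\<close>-th derivative in \<open>t\<close> of the Laurent series with coefficients \<open>a n + half_step n\<close> at
  \<open>- exp t\<close>, continued beyond the circle \<open>norm (exp t) = 1\<close>.
\<close>

definition W :: "(int \<Rightarrow> complex) \<Rightarrow> nat \<Rightarrow> complex \<Rightarrow> complex" where
  "W a j t = poly (logistic_poly j) (1 / (1 + exp t)) + laurent (\<lambda>n. of_int n ^ j * a n) (- exp t)"

text \<open>The point 0 lies on the boundary of \<open>T\<close>, not inside it: identities are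
  proved on \<open>T\<close> and reach 0 by continuity.\<close>

definition T :: "complex set" where "T = {t. norm q < norm (exp t) \<and> norm (exp t) < 1}"

lemma open_T: "open T"
  unfolding T_def by (intro open_Collect_conj open_Collect_less continuous_intros)

lemma exp_in_T: "t \<in> T \<Longrightarrow> exp t \<noteq> - 1" "t \<in> T \<Longrightarrow> norm (exp t) < 1 / norm q"
proof -
  have "1 < 1 / norm q" using q by simp
  thus "t \<in> T \<Longrightarrow> norm (exp t) < 1 / norm q"
    unfolding T_def mem_Collect_eq by linarith
  show "t \<in> T \<Longrightarrow> exp t \<noteq> - 1" unfolding T_def by force
qed

text \<open>The regular part converges on an annulus containing the unit circle, and the logistic
  part is singular only where \<open>exp t = - 1\<close>. Hence \<open>W a j\<close> is
  differentiable at 0 as well.\<close>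

lemma
  assumes "laurent_summable (norm q) (1 / norm q) a"
  shows has_field_derivative_W: "t \<in> T \<Longrightarrow> (W a j has_field_derivative W a (Suc j) t) (at t)"
    and isCont_W_0: "isCont (W a j) 0"
proof -
  have *: "(W a j has_field_derivative W a (Suc j) t) (at t)"
    if "norm q < norm (exp t)" "norm (exp t) < 1 / norm q" "exp t \<noteq> - 1" for t
    unfolding W_def
    by (rule DERIV_add[OF has_field_derivative_logistic_poly has_field_derivative_laurent_exp[where c = "- 1", unfolded mult_minus1, OF assms]])
       (use that in auto)
  show "t \<in> T \<Longrightarrow> (W a j has_field_derivative W a (Suc j) t) (at t)"
    using *[of t] exp_in_T[of t] by (auto simp: T_def)
  show "isCont (W a j) 0"
    by (rule DERIV_isCont[OF *]) (use one_in_annulus in auto)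
qed

text \<open>For \<open>j = 0\<close> this is the geometric series of \<open>half_step\<close>; the
  induction differentiates both sides on the open set \<open>T\<close>.\<close>

lemma W_eq_laurent:
  assumes "laurent_summable (norm q) (1 / norm q) a" "t \<in> T"
  shows "W a j t = laurent (\<lambda>n. of_int n ^ j * (a n + half_step n)) (- exp t)"
  using assms(2)
proof (induction j arbitrary: t)
  case 0
  have t: "norm q < norm (exp t)" "norm (exp t) < 1" "norm (exp t) < 1 / norm q"
    using 0 exp_in_T by (auto simp: T_def)
  have "((\<lambda>n. a n * (- exp t) powi n + half_step n * (- exp t) powi n) has_sum
         laurent a (- exp t) + (1 / (1 - (- exp t)) - 1 / 2)) UNIV"
    unfolding laurent_def
    by (intro has_sum_add has_sum_infsum laurent_summableD[OF assms(1)] has_sum_half_step)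
       (use t in auto)
  hence "laurent (\<lambda>n. a n + half_step n) (- exp t) = laurent a (- exp t) + (1 / (1 - (- exp t)) - 1 / 2)"
    by (simp add: laurent_def distrib_right infsumI)
  thus ?case by (simp add: W_def)
next
  case (Suc j)
  note d = has_field_derivative_laurent_exp[where c = "- 1", unfolded mult_minus1, OF laurent_summable_add_half_step[OF assms(1)], of t j]
  show ?case
    by (rule deriv_unique_on_open[OF open_T Suc(2) Suc.IH has_field_derivative_W[OF assms(1) Suc(2)] d])
       (use Suc.prems in \<open>auto simp: T_def\<close>)
qed

text \<open>\<open>A j\<close> continues the j-th t-derivative of \<Phi> at \<open>- exp t\<close>,
  and \<open>B j\<close> that of the series with coefficients \<open>g\<close>. Thus
  \<open>B 1\<close> is \<Phi>^2 up to the constant \<open>S\<close>.\<close>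

definition A :: "nat \<Rightarrow> complex \<Rightarrow> complex" where "A = W f_reg"
definition B :: "nat \<Rightarrow> complex \<Rightarrow> complex" where "B = W g_reg"

lemma A_deriv: "t \<in> T \<Longrightarrow> (A j has_field_derivative A (Suc j) t) (at t)"
  and B_deriv: "t \<in> T \<Longrightarrow> (B j has_field_derivative B (Suc j) t) (at t)"
  unfolding A_def B_def
  by (simp_all add: has_field_derivative_W laurent_summable_f_reg laurent_summable_g_reg)

lemma isCont_A: "isCont (A j) 0" and isCont_B: "isCont (B j) 0"
  unfolding A_def B_def
  by (simp_all add: isCont_W_0 laurent_summable_f_reg laurent_summable_g_reg)

lemma A_eq: "t \<in> T \<Longrightarrow> A j t = laurent (\<lambda>n. of_int n ^ j * f n) (- exp t)"
  and B_eq: "t \<in> T \<Longrightarrow> B j t = laurent (\<lambda>n. of_int n ^ j * g n) (- exp t)"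
  using W_eq_laurent[OF laurent_summable_f_reg] W_eq_laurent[OF laurent_summable_g_reg]
  by (simp_all add: A_def B_def f_reg_def g_reg_def)

lemma exp_T: "t \<in> T \<Longrightarrow> norm q < norm (- exp t)" "t \<in> T \<Longrightarrow> norm (- exp t) < 1"
  by (auto simp: T_def)

section \<open>The differential equation and its successive derivatives\<close>

lemma A_2: "t \<in> T \<Longrightarrow> A 2 t = 2 * A 0 t ^ 3 - 2 * E * A 0 t"
  using laurent_f_cube[OF exp_T] by (simp add: A_eq algebra_simps)

lemma B_1: "t \<in> T \<Longrightarrow> B 1 t = A 0 t ^ 2 - S"
  using laurent_f_square[OF exp_T] by (simp add: A_eq B_eq)

lemma A_step:
  assumes "t \<in> T" "\<And>t. t \<in> T \<Longrightarrow> A j t = F t" "(F has_field_derivative F') (at t)" "k = Suc j"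
  shows "A k t = F'"
  unfolding assms(4) by (rule deriv_unique_on_open[OF open_T assms(1,2) A_deriv[OF assms(1)] assms(3)])

lemma B_step:
  assumes "t \<in> T" "\<And>t. t \<in> T \<Longrightarrow> B j t = F t" "(F has_field_derivative F') (at t)" "k = Suc j"
  shows "B k t = F'"
  unfolding assms(4) by (rule deriv_unique_on_open[OF open_T assms(1,2) B_deriv[OF assms(1)] assms(3)])

lemma A_3: "t \<in> T \<Longrightarrow> A 3 t = 6 * A 0 t ^ 2 * A 1 t - 2 * E * A 1 t"
  by (rule A_step[OF _ A_2]) (auto intro!: derivative_eq_intros A_deriv simp: eval_nat_numeral algebra_simps)

lemma A_4: "t \<in> T \<Longrightarrow> A 4 t = 12 * A 0 t * A 1 t ^ 2 + 6 * A 0 t ^ 2 * A 2 t - 2 * E * A 2 t"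
  by (rule A_step[OF _ A_3]) (auto intro!: derivative_eq_intros A_deriv simp: eval_nat_numeral algebra_simps)

lemma A_5: "t \<in> T \<Longrightarrow> A 5 t = 12 * A 1 t ^ 3 + 36 * A 0 t * A 1 t * A 2 t + 6 * A 0 t ^ 2 * A 3 t - 2 * E * A 3 t"
  by (rule A_step[OF _ A_4]) (auto intro!: derivative_eq_intros A_deriv simp: eval_nat_numeral algebra_simps)

lemma B_2: "t \<in> T \<Longrightarrow> B 2 t = 2 * A 0 t * A 1 t"
  by (rule B_step[OF _ B_1]) (auto intro!: derivative_eq_intros A_deriv simp: eval_nat_numeral algebra_simps)

lemma B_3: "t \<in> T \<Longrightarrow> B 3 t = 2 * A 1 t ^ 2 + 2 * A 0 t * A 2 t"
  by (rule B_step[OF _ B_2]) (auto intro!: derivative_eq_intros A_deriv simp: eval_nat_numeral algebra_simps)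

lemma B_4: "t \<in> T \<Longrightarrow> B 4 t = 6 * A 1 t * A 2 t + 2 * A 0 t * A 3 t"
  by (rule B_step[OF _ B_3]) (auto intro!: derivative_eq_intros A_deriv simp: eval_nat_numeral algebra_simps)

lemma B_5: "t \<in> T \<Longrightarrow> B 5 t = 6 * A 2 t ^ 2 + 8 * A 1 t * A 3 t + 2 * A 0 t * A 4 t"
  by (rule B_step[OF _ B_4]) (auto intro!: derivative_eq_intros A_deriv simp: eval_nat_numeral algebra_simps)

lemma B_6: "t \<in> T \<Longrightarrow> B 6 t = 20 * A 2 t * A 3 t + 10 * A 1 t * A 4 t + 2 * A 0 t * A 5 t"
  by (rule B_step[OF _ B_5]) (auto intro!: derivative_eq_intros A_deriv simp: eval_nat_numeral algebra_simps)

lemma B_7: "t \<in> T \<Longrightarrow> B 7 t = 20 * A 3 t ^ 2 + 30 * A 2 t * A 4 t + 12 * A 1 t * A 5 t + 2 * A 0 t * A 6 t"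
  by (rule B_step[OF _ B_6]) (auto intro!: derivative_eq_intros A_deriv simp: eval_nat_numeral algebra_simps)

section \<open>Passage to the origin and the values there\<close>

lemma filterlim_T: "filterlim complex_of_real (nhds 0) (at_left 0)"
  "eventually (\<lambda>x. complex_of_real x \<in> T) (at_left 0)"
proof -
  show "filterlim complex_of_real (nhds 0) (at_left 0)"
    by (rule tendsto_eq_intros refl)+ simp
  have "((\<lambda>x::real. exp x) \<longlongrightarrow> 1) (at_left 0)"
    by (rule tendsto_eq_intros refl)+ simp
  hence "eventually (\<lambda>x. exp x > norm q) (at_left (0::real))"
    using q(2) by (simp add: order_tendsto_iff)
  moreover have "eventually (\<lambda>x. x < 0) (at_left (0::real))"
    by (simp add: eventually_at_filter)
  ultimately show "eventually (\<lambda>x. complex_of_real x \<in> T) (at_left 0)"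
    by eventually_elim (simp add: T_def)
qed

text \<open>Small negative reals lie in \<open>T\<close>, so both functions have the same limit
  along them.\<close>

lemma eq_at_0:
  assumes "\<And>t. t \<in> T \<Longrightarrow> u t = v t" "isCont u 0" "isCont v (0 :: complex)"
  shows "u 0 = (v 0 :: complex)"
proof (rule tendsto_unique)
  show "((\<lambda>x. u (complex_of_real x)) \<longlongrightarrow> u 0) (at_left 0)"
    using isCont_tendsto_compose[OF assms(2) filterlim_T(1)] .
  have "((\<lambda>x. v (complex_of_real x)) \<longlongrightarrow> v 0) (at_left 0)"
    using isCont_tendsto_compose[OF assms(3) filterlim_T(1)] .
  thus "((\<lambda>x. u (complex_of_real x)) \<longlongrightarrow> v 0) (at_left 0)"
    by (rule Lim_transform_eventually) (use filterlim_T(2) assms(1) in \<open>auto elim: eventually_mono\<close>)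
qed simp

text \<open>At \<open>t = 0\<close> the series is read at x = -1 and the logistic variable is 1/2.
  As \<open>a\<close> is odd, the summand is even for odd \<open>j\<close>, which doubles the
  positive half, and odd for even \<open>j\<close>, which gives 0.\<close>

lemma W_0_odd_coeff:
  assumes "laurent_summable (norm q) (1 / norm q) a" "\<And>n. a (- n) = - a n"
  shows "odd j \<Longrightarrow> W a j 0 = poly (logistic_poly j) (1 / 2) +
            2 * (\<Sum>\<^sub>\<infinity>r\<in>{1::nat..}. (- 1) ^ r * (of_nat r ^ j * a (int r)))"
    and "even j \<Longrightarrow> W a j 0 = poly (logistic_poly j) (1 / 2)"
proof -
  let ?h = "\<lambda>n. of_int n ^ j * a n * (- 1) powi n"
  have sm: "?h summable_on UNIV"
    using laurent_summableD[OF laurent_summable_theta_power[OF assms(1), of j], of "- 1"] one_in_annulus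
    by simp
  have W: "W a j 0 = poly (logistic_poly j) (1 / 2) + infsum ?h UNIV"
    by (simp add: W_def laurent_def)
  show "W a j 0 = poly (logistic_poly j) (1 / 2) +
            2 * (\<Sum>\<^sub>\<infinity>r\<in>{1::nat..}. (- 1) ^ r * (of_nat r ^ j * a (int r)))" if "odd j"
    using infsum_even_int[OF sm] assms(2) that unfolding W
    by (simp add: power_int_minus_left odd_pos mult_ac)
  show "W a j 0 = poly (logistic_poly j) (1 / 2)" if "even j"
  proof -
    have "infsum ?h UNIV = infsum (\<lambda>n. ?h (- n)) UNIV"
      by (rule infsum_reindex_bij_witness[of _ uminus uminus]) auto
    also have "(\<lambda>n. ?h (- n)) = (\<lambda>n. - ?h n)"
      using that by (auto simp: fun_eq_iff assms(2) power_int_minus_left)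
    finally have "infsum ?h UNIV = 0" by (simp add: infsum_uminus)
    thus ?thesis using W by simp
  qed
qed

lemma A_0_odd: "odd j \<Longrightarrow> A j 0 = poly (logistic_poly j) (1 / 2) + 2 * U j q"
  and A_0_even: "even j \<Longrightarrow> A j 0 = poly (logistic_poly j) (1 / 2)"
  and B_0_odd: "odd j \<Longrightarrow> B j 0 = poly (logistic_poly j) (1 / 2) + 2 * G j q"
proof -
  show "even j \<Longrightarrow> A j 0 = poly (logistic_poly j) (1 / 2)"
    unfolding A_def by (rule W_0_odd_coeff[OF laurent_summable_f_reg f_reg_minus])
  have "U j q = (\<Sum>\<^sub>\<infinity>r\<in>{1::nat..}. (- 1) ^ r * (of_nat r ^ j * f_reg (int r)))"
    unfolding U_def
  proof (rule infsum_cong)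
    fix r :: nat assume "r \<in> {1..}"
    \<comment> \<open>The minus sign in \<open>f_reg_pos\<close> accounts for the exponent
      \<open>r - 1\<close> in \<open>U\<close>.\<close>
    hence "(- 1) ^ (r - 1) = - ((- 1) ^ r :: complex)" "r > 0" by (cases r; simp)+
    thus "(-1) ^ (r - 1) * (of_nat r ^ j * q ^ r / (1 + q ^ r)) = (- 1) ^ r * (of_nat r ^ j * f_reg (int r))"
      by (simp add: f_reg_pos)
  qed
  thus "odd j \<Longrightarrow> A j 0 = poly (logistic_poly j) (1 / 2) + 2 * U j q"
    unfolding A_def using W_0_odd_coeff(1)[OF laurent_summable_f_reg f_reg_minus, of j] by simp
  have "G j q = (\<Sum>\<^sub>\<infinity>r\<in>{1::nat..}. (- 1) ^ r * (of_nat r ^ j * g_reg (int r)))"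
    unfolding G_def by (rule infsum_cong) (subst g_reg_pos; simp)
  thus "odd j \<Longrightarrow> B j 0 = poly (logistic_poly j) (1 / 2) + 2 * G j q"
    unfolding B_def using W_0_odd_coeff(1)[OF laurent_summable_g_reg g_reg_minus, of j] by simp
qed

text \<open>These are derivatives at 0 of 1/(1 + exp t) - 1/2 = - tanh(t/2)/2; they produce the
  additive constants in the determinants.\<close>

lemma logistic_poly_values:
  "poly (logistic_poly 0) (1 / 2) = 0" "poly (logistic_poly 1) (1 / 2) = - 1 / 4"
  "poly (logistic_poly 2) (1 / 2) = 0" "poly (logistic_poly 3) (1 / 2) = 1 / 8"
  "poly (logistic_poly 4) (1 / 2) = 0" "poly (logistic_poly 5) (1 / 2) = - 1 / 4"
  "poly (logistic_poly 7) (1 / 2) = 17 / 16"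
  by (simp_all add: eval_nat_numeral pderiv_pCons)

lemma A_values: "A 0 0 = 0" "A 1 0 = 2 * U 1 q - 1 / 4" "A 2 0 = 0" "A 3 0 = 2 * U 3 q + 1 / 8"
  "A 4 0 = 0" "A 5 0 = 2 * U 5 q - 1 / 4"
  and B_values: "B 3 0 = 2 * G 3 q + 1 / 8" "B 5 0 = 2 * G 5 q - 1 / 4" "B 7 0 = 2 * G 7 q + 17 / 16"
  by (simp_all add: A_0_odd A_0_even B_0_odd logistic_poly_values del: logistic_poly.simps One_nat_def)

text \<open>\<Phi> is odd in t, so every term with a factor \<open>A 0 0\<close> or
  \<open>A 2 0\<close> drops out.\<close>

lemma relations_at_0:
  "A 3 0 = - 2 * E * A 1 0" "A 5 0 = 12 * A 1 0 ^ 3 - 2 * E * A 3 0"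
  "B 3 0 = 2 * A 1 0 ^ 2" "B 5 0 = 8 * A 1 0 * A 3 0" "B 7 0 = 20 * A 3 0 ^ 2 + 12 * A 1 0 * A 5 0"
proof -
  have "A 3 0 = 6 * A 0 0 ^ 2 * A 1 0 - 2 * E * A 1 0"
    by (rule eq_at_0[of "A 3", OF A_3]) (auto intro!: continuous_intros isCont_A)
  thus "A 3 0 = - 2 * E * A 1 0" by (simp add: A_values)
  have "A 5 0 = 12 * A 1 0 ^ 3 + 36 * A 0 0 * A 1 0 * A 2 0 + 6 * A 0 0 ^ 2 * A 3 0 - 2 * E * A 3 0"
    by (rule eq_at_0[of "A 5", OF A_5]) (auto intro!: continuous_intros isCont_A)
  thus "A 5 0 = 12 * A 1 0 ^ 3 - 2 * E * A 3 0" by (simp add: A_values(1,3))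
  have "B 3 0 = 2 * A 1 0 ^ 2 + 2 * A 0 0 * A 2 0"
    by (rule eq_at_0[of "B 3", OF B_3]) (auto intro!: continuous_intros isCont_A isCont_B)
  thus "B 3 0 = 2 * A 1 0 ^ 2" by (simp add: A_values(1,3))
  have "B 5 0 = 6 * A 2 0 ^ 2 + 8 * A 1 0 * A 3 0 + 2 * A 0 0 * A 4 0"
    by (rule eq_at_0[of "B 5", OF B_5]) (auto intro!: continuous_intros isCont_A isCont_B)
  thus "B 5 0 = 8 * A 1 0 * A 3 0" by (simp add: A_values(1,3))
  have "B 7 0 = 20 * A 3 0 ^ 2 + 30 * A 2 0 * A 4 0 + 12 * A 1 0 * A 5 0 + 2 * A 0 0 * A 6 0"
    by (rule eq_at_0[of "B 7", OF B_7]) (auto intro!: continuous_intros isCont_A isCont_B)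
  thus "B 7 0 = 20 * A 3 0 ^ 2 + 12 * A 1 0 * A 5 0" by (simp add: A_values(1,3))
qed

end

subsection \<open>Theta constants under doubling of the nome\<close>

text \<open>Quadratic exponents beat any geometric rate: choose \<open>N\<close> with
  \<open>norm p ^ N < r\<close>; beyond \<open>N\<close> the terms are at most r^|n|, and the
  constant \<open>(1 / r) ^ N\<close> covers the remaining indices. The bound on \<open>h\<close> is
  a common minorant of n^2 - n, n^2 + n, n^2 and 2 n^2.\<close>

lemma laurent_summable_theta_like:
  fixes p :: complex
  assumes p: "0 < norm p" "norm p < 1" and r: "0 < r" "r < 1"
    and h: "\<And>n. \<bar>n\<bar> * (\<bar>n\<bar> - 1) \<le> h n" and c: "\<And>n. norm (c n) \<le> 1"
  shows "laurent_summable r (1 / r) (\<lambda>n. c n * p powi h n)"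
proof -
  obtain N where N: "norm p ^ N < r" using real_arch_pow_inv[OF r(1) p(2)] by blast
  have h0: "h n \<ge> 0" for n
  proof (cases "n = 0")
    case False
    hence "0 \<le> \<bar>n\<bar> * (\<bar>n\<bar> - 1)" by (intro mult_nonneg_nonneg) auto
    thus ?thesis using h[of n] by linarith
  qed (use h[of 0] in simp)
  show ?thesis
  proof (rule laurent_summable_geometric_bound[where C = "(1 / r) ^ N"])
    fix n :: int
    define m where "m = nat \<bar>n\<bar>"
    have m: "\<bar>n\<bar> = int m" by (simp add: m_def)
    have pow: "norm (p powi h n) = norm p ^ nat (h n)"
      using h0[of n] by (simp add: power_int_def norm_power)
    have "norm p ^ nat (h n) \<le> (1 / r) ^ N * r ^ m"
    proof (cases "m \<le> N")
      case True
      have "norm p ^ nat (h n) \<le> 1" using p by (simp add: power_le_one)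
      also have "1 \<le> (1 / r) ^ (N - m)" using r by (intro one_le_power) auto
      also have "\<dots> = (1 / r) ^ N * r ^ m" using r True by (simp add: power_diff power_one_over)
      finally show ?thesis .
    next
      case False
      hence "int m * int N \<le> int m * (int m - 1)" by (intro mult_left_mono) auto
      also have "\<dots> \<le> h n" using h[of n] m by simp
      finally have "N * m \<le> nat (h n)" using h0[of n]
        by (metis mult.commute nat_le_iff of_nat_mult zle_int int_nat_eq)
      hence "norm p ^ nat (h n) \<le> norm p ^ (N * m)" using p by (intro power_decreasing) auto
      also have "\<dots> \<le> r ^ m" unfolding power_mult using N by (intro power_mono) auto
      also have "\<dots> \<le> (1 / r) ^ N * r ^ m" using r one_le_power[of "1 / r" N] by simp
      finally show ?thesis .
    qed
    hence "norm (p powi h n) \<le> (1 / r) ^ N * r powi \<bar>n\<bar>" using m pow by simp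
    moreover have "norm (c n) * norm (p powi h n) \<le> 1 * norm (p powi h n)"
      by (intro mult_right_mono c) auto
    ultimately show "norm (c n * p powi h n) \<le> (1 / r) ^ N * r powi \<bar>n\<bar>"
      by (simp add: norm_mult)
  qed fact
qed

lemma summable_theta_like:
  fixes p :: complex
  assumes p: "0 < norm p" "norm p < 1"
    and h: "\<And>n. \<bar>n\<bar> * (\<bar>n\<bar> - 1) \<le> h n" and c: "\<And>n. norm (c n) \<le> 1"
  shows "(\<lambda>n. c n * p powi h n) summable_on UNIV"
    and "(\<lambda>n. of_int n * (c n * p powi h n)) summable_on UNIV"
proof -
  note l = laurent_summable_theta_like[OF p, of "1 / 2", OF _ _ h c]
  show "(\<lambda>n. c n * p powi h n) summable_on UNIV"
    using laurent_summableD[OF l, of 1] by simp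
  show "(\<lambda>n. of_int n * (c n * p powi h n)) summable_on UNIV"
    using laurent_summableD[OF laurent_summable_theta[OF l], of 1] by simp
qed

lemma abs_mult_pred_le: "\<bar>n\<bar> * (\<bar>n\<bar> - 1) \<le> n ^ 2 - n" "\<bar>n\<bar> * (\<bar>n\<bar> - 1) \<le> n ^ 2 + n" "\<bar>n\<bar> * (\<bar>n\<bar> - 1) \<le> n ^ 2"
  "\<bar>n\<bar> * (\<bar>n\<bar> - 1) \<le> 2 * n ^ 2" for n :: int
proof -
  show "\<bar>n\<bar> * (\<bar>n\<bar> - 1) \<le> n ^ 2 - n" "\<bar>n\<bar> * (\<bar>n\<bar> - 1) \<le> n ^ 2 + n" and *: "\<bar>n\<bar> * (\<bar>n\<bar> - 1) \<le> n ^ 2"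
    by (auto simp: abs_if algebra_simps power2_eq_square)
  show "\<bar>n\<bar> * (\<bar>n\<bar> - 1) \<le> 2 * n ^ 2" using * zero_le_power2[of n] by linarith
qed

definition sgn_pow :: "int \<Rightarrow> complex" where "sgn_pow n = (if even n then 1 else - 1)"

lemma norm_sgn_pow [simp]: "norm (sgn_pow n) = 1"
  by (simp add: sgn_pow_def)

lemma sgn_pow_eq: "sgn_pow n = (- 1) powi n"
  by (simp add: sgn_pow_def power_int_minus_left)

lemma power2_powi: "(p ^ 2) powi k = p powi (2 * k)" for p :: complex
  by (simp add: power_int_mult)

lemma powi_mult_cong:
  fixes p :: complex
  assumes "p \<noteq> 0" "a + b = c + d"
  shows "p powi a * p powi b = p powi c * p powi d"
  using assms by (simp flip: power_int_add)

text \<open>\<open>thY p\<close> and \<open>thX p\<close> are \<open>\<vartheta>(1)\<close> and \<open>\<vartheta>'(-1)\<close> for the theta series \<open>\<vartheta>(x) = \<Sum>\<^sub>n p\<^bsup>n\<^sup>2 - n\<^esup> x\<^sup>n\<close>.\<close>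

definition thY :: "complex \<Rightarrow> complex" where "thY p = (\<Sum>\<^sub>\<infinity>n. p powi (n ^ 2 - n))"
definition thX :: "complex \<Rightarrow> complex" where "thX p = (\<Sum>\<^sub>\<infinity>n. of_int n * (- sgn_pow n * p powi (n ^ 2 - n)))"

lemma minus_powi_square: "(- q) powi (n ^ 2) = sgn_pow n * q powi (n ^ 2)" for q :: complex
  by (simp add: sgn_pow_def power_int_minus_left)

lemma has_sum_reflect:
  fixes F :: "int \<Rightarrow> complex"
  shows "((\<lambda>n. F (m - n)) has_sum s) UNIV \<longleftrightarrow> (F has_sum s) UNIV"
  by (rule has_sum_reindex_bij_witness[of _ "\<lambda>n. m - n" "\<lambda>n. m - n"]) auto

lemma has_sum_antisymmetric:
  fixes F :: "int \<Rightarrow> complex"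
  assumes "F summable_on UNIV" "\<And>n. F (m - n) = - F n"
  shows "(F has_sum 0) UNIV"
proof -
  obtain s where s: "(F has_sum s) UNIV" using assms(1) by (auto simp: summable_on_def)
  hence "((\<lambda>n. F (m - n)) has_sum s) UNIV" by (simp add: has_sum_reflect)
  hence "((\<lambda>n. - F n) has_sum s) UNIV" unfolding assms(2) .
  hence "(F has_sum - s) UNIV" by (simp add: has_sum_uminus)
  with s have "s = - s" by (rule has_sum_unique)
  with s show ?thesis by simp
qed

text \<open>
  The substitutions \<open>(m, n) = (M + j, M - j)\<close> and \<open>(M + 1 + j, M - j)\<close> parametrise the pairs with even and
  odd sum; they diagonalise \<open>m\<^sup>2 + n\<^sup>2\<close> and so turn products of theta constants into theta constants at \<open>p\<^sup>2\<close>.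
\<close>

lemma has_sum_parity_split:
  fixes F :: "int \<times> int \<Rightarrow> complex"
  assumes "(F has_sum s) (UNIV \<times> UNIV)"
    and "((\<lambda>(M, j). F (M + j, M - j)) has_sum a) (UNIV \<times> UNIV)"
    and "((\<lambda>(M, j). F (M + 1 + j, M - j)) has_sum b) (UNIV \<times> UNIV)"
  shows "s = a + b"
proof -
  define Ev Od where "Ev = {(m :: int, n :: int). even (m + n)}" and "Od = {(m :: int, n :: int). odd (m + n)}"
  have ev: "(m + n) div 2 + (m - n) div 2 = m" "(m + n) div 2 - (m - n) div 2 = n" if "even (m + n)" for m n :: int
    using that by presburger+
  have "bij_betw (\<lambda>(M, j). (M + j, M - j)) (UNIV \<times> UNIV) Ev"
    by (rule bij_betwI[where g = "\<lambda>(m, n). ((m + n) div 2, (m - n) div 2)"])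
       (auto simp only: Ev_def mem_Collect_eq prod.case ev, auto)
  from assms(2) this have "(F has_sum a) Ev"
    by (auto dest!: has_sum_reindex_bij_betw[of _ _ _ F a] simp: split_def)
  moreover have "bij_betw (\<lambda>(M, j). (M + 1 + j, M - j)) (UNIV \<times> UNIV) Od"
    by (rule bij_betwI[where g = "\<lambda>(m, n). ((m + n) div 2, (m - n) div 2)"])
       (auto simp: Od_def, presburger+)
  with assms(3) have "(F has_sum b) Od"
    by (auto dest!: has_sum_reindex_bij_betw[of _ _ _ F b] simp: split_def)
  moreover have "Ev \<inter> Od = {}" "Ev \<union> Od = UNIV \<times> UNIV" by (auto simp: Ev_def Od_def)
  ultimately have "(F has_sum a + b) (UNIV \<times> UNIV)"
    using has_sum_Un_disjoint by metis
  thus ?thesis using assms(1) has_sum_unique by blast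
qed

section \<open>Theta constants as sums over the integers\<close>

context
  fixes p :: complex
  assumes p: "0 < norm p" "norm p < 1"
begin

lemma p_nz: "p \<noteq> 0" using p by auto

lemma has_sum_thY: "((\<lambda>n. p powi (n ^ 2 - n)) has_sum thY p) UNIV"
  unfolding thY_def
  using has_sum_infsum[OF summable_theta_like(1)[OF p abs_mult_pred_le(1), of "\<lambda>_. 1"]] by simp

lemma has_sum_thY': "((\<lambda>n. p powi (n ^ 2 + n)) has_sum thY p) UNIV"
  using has_sum_thY has_sum_reflect[of "\<lambda>n. p powi (n ^ 2 - n)" 0] by simp

lemma has_sum_thX: "((\<lambda>n. of_int n * (- sgn_pow n * p powi (n ^ 2 - n))) has_sum thX p) UNIV"
  unfolding thX_def
  by (rule has_sum_infsum[OF summable_theta_like(2)[OF p abs_mult_pred_le(1)]]) simp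

text \<open>The shift by one gives the exponent n^2 + n that arises from pairs with odd sum.\<close>

lemma has_sum_thX': "((\<lambda>n. (of_int n + 1) * (sgn_pow n * p powi (n ^ 2 + n))) has_sum thX p) UNIV"
proof -
  have eq: "of_int (n + 1) * (- sgn_pow (n + 1) * p powi ((n + 1) ^ 2 - (n + 1))) =
        (of_int n + 1) * (sgn_pow n * p powi (n ^ 2 + n))" for n
    by (simp add: sgn_pow_def power2_eq_square algebra_simps)
  have "((\<lambda>n. of_int (n + 1) * (- sgn_pow (n + 1) * p powi ((n + 1) ^ 2 - (n + 1)))) has_sum thX p) UNIV"
    by (subst has_sum_reindex_bij_witness[of _ "\<lambda>n. n - 1" "\<lambda>n. n + 1" UNIV
          "\<lambda>n. of_int n * (- sgn_pow n * p powi (n ^ 2 - n))" _ _ "thX p"]) (use has_sum_thX in auto)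
  thus ?thesis unfolding eq .
qed

lemma has_sum_theta3: "((\<lambda>n. p powi (n ^ 2)) has_sum theta3_null p) UNIV"
  unfolding theta3_null_def
  using has_sum_infsum[OF summable_theta_like(1)[OF p abs_mult_pred_le(3), of "\<lambda>_. 1"]] by simp

lemma has_sum_theta4: "((\<lambda>n. sgn_pow n * p powi (n ^ 2)) has_sum theta3_null (- p)) UNIV"
  unfolding theta3_null_def minus_powi_square
  by (rule has_sum_infsum[OF summable_theta_like(1)[OF p abs_mult_pred_le(3)]]) simp

text \<open>The reflections n -> 1 - n, n -> -1 - n and n -> -n respectively preserve the exponent
  and reverse the sign.\<close>

lemma has_sum_zero:
  "((\<lambda>n. sgn_pow n * p powi (n ^ 2 - n)) has_sum 0) UNIV"
  "((\<lambda>n. sgn_pow n * p powi (n ^ 2 + n)) has_sum 0) UNIV"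
  "((\<lambda>n. of_int n * (sgn_pow n * p powi (n ^ 2))) has_sum 0) UNIV"
proof -
  show "((\<lambda>n. sgn_pow n * p powi (n ^ 2 - n)) has_sum 0) UNIV"
    by (rule has_sum_antisymmetric[where m = 1], rule summable_theta_like(1)[OF p abs_mult_pred_le(1)])
       (auto simp: sgn_pow_def power2_eq_square algebra_simps)
  show "((\<lambda>n. sgn_pow n * p powi (n ^ 2 + n)) has_sum 0) UNIV"
    by (rule has_sum_antisymmetric[where m = "-1"], rule summable_theta_like(1)[OF p abs_mult_pred_le(2)])
       (auto simp: sgn_pow_def power2_eq_square algebra_simps)
  show "((\<lambda>n. of_int n * (sgn_pow n * p powi (n ^ 2))) has_sum 0) UNIV"
    by (rule has_sum_antisymmetric[where m = 0], rule summable_theta_like(2)[OF p abs_mult_pred_le(3)])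
       (auto simp: sgn_pow_def)
qed

end

section \<open>Identities relating the nomes \<open>p\<close> and \<open>p ^ 2\<close>\<close>

context
  fixes p :: complex
  assumes p: "0 < norm p" "norm p < 1"
begin

lemma p2: "0 < norm (p ^ 2)" "norm (p ^ 2) < 1"
  using p by (simp_all add: norm_power power_less_one_iff)

text \<open>The two parity classes contribute equally. As \<open>thY p\<close> is p^(-1/4) times
  Jacobi's \<theta>_2, this is the classical formula for \<theta>_2^2.\<close>

lemma thY_square: "thY p ^ 2 = 2 * theta3_null (p ^ 2) * thY (p ^ 2)"
proof -
  let ?F = "\<lambda>(m, n). p powi (m ^ 2 - m) * p powi (n ^ 2 - n)"
  have "(?F has_sum thY p * thY p) (UNIV \<times> UNIV)"
    by (rule has_sum_times[OF has_sum_thY has_sum_thY]) (fact p)+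
  moreover have "((\<lambda>(M, j). ?F (M + j, M - j)) has_sum thY (p ^ 2) * theta3_null (p ^ 2)) (UNIV \<times> UNIV)"
  proof -
    have "p powi ((M + j) ^ 2 - (M + j)) * p powi ((M - j) ^ 2 - (M - j)) =
          (p ^ 2) powi (M ^ 2 - M) * (p ^ 2) powi (j ^ 2)" for M j
      unfolding power2_powi
      by (rule powi_mult_cong[OF p_nz[OF p]]) (simp add: power2_eq_square algebra_simps)
    thus ?thesis using has_sum_times[OF has_sum_thY[OF p2] has_sum_theta3[OF p2]] by simp
  qed
  moreover have "((\<lambda>(M, j). ?F (M + 1 + j, M - j)) has_sum theta3_null (p ^ 2) * thY (p ^ 2)) (UNIV \<times> UNIV)"
  proof -
    have "p powi ((M + 1 + j) ^ 2 - (M + 1 + j)) * p powi ((M - j) ^ 2 - (M - j)) =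
          (p ^ 2) powi (M ^ 2) * (p ^ 2) powi (j ^ 2 + j)" for M j
      unfolding power2_powi
      by (rule powi_mult_cong[OF p_nz[OF p]]) (simp add: power2_eq_square algebra_simps)
    thus ?thesis using has_sum_times[OF has_sum_theta3[OF p2] has_sum_thY'[OF p2]] by simp
  qed
  ultimately have "thY p * thY p = thY (p ^ 2) * theta3_null (p ^ 2) + theta3_null (p ^ 2) * thY (p ^ 2)"
    by (rule has_sum_parity_split)
  thus ?thesis by (simp add: power2_eq_square)
qed

text \<open>Pairs with even sum give the square; pairs with odd sum cancel by
  \<open>has_sum_zero\<close>.\<close>

lemma theta4_square: "theta3_null (- (p ^ 2)) ^ 2 = theta3_null p * theta3_null (- p)"
proof -
  let ?F = "\<lambda>(m, n). p powi (m ^ 2) * (sgn_pow n * p powi (n ^ 2))"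
  have "(?F has_sum theta3_null p * theta3_null (- p)) (UNIV \<times> UNIV)"
    by (rule has_sum_times[OF has_sum_theta3 has_sum_theta4]) (fact p)+
  moreover have "((\<lambda>(M, j). ?F (M + j, M - j)) has_sum
      theta3_null (- (p ^ 2)) * theta3_null (- (p ^ 2))) (UNIV \<times> UNIV)"
  proof -
    have "p powi ((M + j) ^ 2) * p powi ((M - j) ^ 2) = (p ^ 2) powi (M ^ 2) * (p ^ 2) powi (j ^ 2)" for M j
      unfolding power2_powi
      by (rule powi_mult_cong[OF p_nz[OF p]]) (simp add: power2_eq_square algebra_simps)
    hence "(\<lambda>(M, j). ?F (M + j, M - j)) =
        (\<lambda>(M, j). sgn_pow M * (p ^ 2) powi (M ^ 2) * (sgn_pow j * (p ^ 2) powi (j ^ 2)))"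
      by (auto simp: fun_eq_iff sgn_pow_def)
    thus ?thesis using has_sum_times[OF has_sum_theta4[OF p2] has_sum_theta4[OF p2]] by simp
  qed
  moreover have "((\<lambda>(M, j). ?F (M + 1 + j, M - j)) has_sum 0) (UNIV \<times> UNIV)"
  proof -
    have "((\<lambda>(M, j). p * (sgn_pow M * (p ^ 2) powi (M ^ 2 + M)) * (sgn_pow j * (p ^ 2) powi (j ^ 2 + j))) has_sum
           p * 0 * 0) (UNIV \<times> UNIV)"
      by (intro has_sum_times has_sum_cmult_right has_sum_zero p2)
    moreover have "(\<lambda>(M, j). ?F (M + 1 + j, M - j)) =
        (\<lambda>(M, j). p * (sgn_pow M * (p ^ 2) powi (M ^ 2 + M)) * (sgn_pow j * (p ^ 2) powi (j ^ 2 + j)))"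
    proof -
      have "p powi ((M + 1 + j) ^ 2) * p powi ((M - j) ^ 2) =
            p * (p ^ 2) powi (M ^ 2 + M) * (p ^ 2) powi (j ^ 2 + j)" for M j
      proof -
        have "(M + 1 + j) ^ 2 + (M - j) ^ 2 = 1 + 2 * (M ^ 2 + M) + 2 * (j ^ 2 + j)"
          by (simp add: power2_eq_square algebra_simps)
        hence "p powi ((M + 1 + j) ^ 2 + (M - j) ^ 2) = p powi (1 + 2 * (M ^ 2 + M) + 2 * (j ^ 2 + j))"
          by simp
        thus ?thesis using p_nz[OF p] unfolding power2_powi by (simp only: power_int_add power_int_1_right simp_thms)
      qed
      thus ?thesis by (auto simp: fun_eq_iff sgn_pow_def)
    qed
    ultimately show ?thesis by simp
  qed
  ultimately have "theta3_null p * theta3_null (- p) = theta3_null (- (p ^ 2)) * theta3_null (- (p ^ 2)) + 0"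
    by (rule has_sum_parity_split)
  thus ?thesis by (simp add: power2_eq_square)
qed

text \<open>The weight \<open>m\<close> is \<open>M + j\<close> or \<open>M + (j + 1)\<close>. In
  each parity class one of its two parts multiplies a vanishing sum, and the other gives
  \<open>thX (p ^ 2)\<close> times the theta constant.\<close>

lemma thX_thY: "thX p * thY p = 2 * theta3_null (- (p ^ 2)) * thX (p ^ 2)"
proof -
  let ?F = "\<lambda>(m, n). of_int m * (- sgn_pow m * p powi (m ^ 2 - m)) * p powi (n ^ 2 - n)"
  have "(?F has_sum thX p * thY p) (UNIV \<times> UNIV)"
    by (rule has_sum_times[OF has_sum_thX has_sum_thY]) (fact p)+
  moreover have "((\<lambda>(M, j). ?F (M + j, M - j)) has_sum
      thX (p ^ 2) * theta3_null (- (p ^ 2)) - 0 * 0) (UNIV \<times> UNIV)"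
  proof -
    have e: "p powi ((M + j) ^ 2 - (M + j)) * p powi ((M - j) ^ 2 - (M - j)) =
          (p ^ 2) powi (M ^ 2 - M) * (p ^ 2) powi (j ^ 2)" for M j
      unfolding power2_powi
      by (rule powi_mult_cong[OF p_nz[OF p]]) (simp add: power2_eq_square algebra_simps)
    have Feq: "?F (M + j, M - j) = 
        of_int M * (- sgn_pow M * (p ^ 2) powi (M ^ 2 - M)) * (sgn_pow j * (p ^ 2) powi (j ^ 2)) -
        sgn_pow M * (p ^ 2) powi (M ^ 2 - M) * (of_int j * (sgn_pow j * (p ^ 2) powi (j ^ 2)))" for M j
    proof -
      have "?F (M + j, M - j) = of_int (M + j) * - sgn_pow (M + j) * 
          (p powi ((M + j) ^ 2 - (M + j)) * p powi ((M - j) ^ 2 - (M - j)))" by simp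
      moreover have "sgn_pow (M + j) = sgn_pow M * sgn_pow j" by (simp add: sgn_pow_def)
      ultimately show ?thesis unfolding e by (simp add: algebra_simps)
    qed
    have "(\<lambda>(M, j). ?F (M + j, M - j)) = (\<lambda>x.
        (case x of (M, j) \<Rightarrow> of_int M * (- sgn_pow M * (p ^ 2) powi (M ^ 2 - M)) * (sgn_pow j * (p ^ 2) powi (j ^ 2))) -
        (case x of (M, j) \<Rightarrow> sgn_pow M * (p ^ 2) powi (M ^ 2 - M) * (of_int j * (sgn_pow j * (p ^ 2) powi (j ^ 2)))))"
      by (intro ext, clarify) (rule Feq[unfolded prod.case])
    moreover have "(\<dots> has_sum thX (p ^ 2) * theta3_null (- (p ^ 2)) - 0 * 0) (UNIV \<times> UNIV)"
      by (intro has_sum_minus has_sum_times has_sum_thX has_sum_theta4 has_sum_zero p2)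
    ultimately show ?thesis by simp
  qed
  moreover have "((\<lambda>(M, j). ?F (M + 1 + j, M - j)) has_sum
      theta3_null (- (p ^ 2)) * thX (p ^ 2) + 0 * 0) (UNIV \<times> UNIV)"
  proof -
    have e: "p powi ((M + 1 + j) ^ 2 - (M + 1 + j)) * p powi ((M - j) ^ 2 - (M - j)) =
          (p ^ 2) powi (M ^ 2) * (p ^ 2) powi (j ^ 2 + j)" for M j
      unfolding power2_powi
      by (rule powi_mult_cong[OF p_nz[OF p]]) (simp add: power2_eq_square algebra_simps)
    have Feq: "?F (M + 1 + j, M - j) = 
        sgn_pow M * (p ^ 2) powi (M ^ 2) * ((of_int j + 1) * (sgn_pow j * (p ^ 2) powi (j ^ 2 + j))) +
        of_int M * (sgn_pow M * (p ^ 2) powi (M ^ 2)) * (sgn_pow j * (p ^ 2) powi (j ^ 2 + j))" for M j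
    proof -
      have "?F (M + 1 + j, M - j) = of_int (M + 1 + j) * - sgn_pow (M + 1 + j) * 
          (p powi ((M + 1 + j) ^ 2 - (M + 1 + j)) * p powi ((M - j) ^ 2 - (M - j)))" by simp
      moreover have "sgn_pow (M + 1 + j) = - (sgn_pow M * sgn_pow j)" by (simp add: sgn_pow_def)
      ultimately show ?thesis unfolding e by (simp add: algebra_simps)
    qed
    have "(\<lambda>(M, j). ?F (M + 1 + j, M - j)) = (\<lambda>x.
        (case x of (M, j) \<Rightarrow> sgn_pow M * (p ^ 2) powi (M ^ 2) * ((of_int j + 1) * (sgn_pow j * (p ^ 2) powi (j ^ 2 + j)))) +
        (case x of (M, j) \<Rightarrow> of_int M * (sgn_pow M * (p ^ 2) powi (M ^ 2)) * (sgn_pow j * (p ^ 2) powi (j ^ 2 + j))))"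
      by (intro ext, clarify) (rule Feq[unfolded prod.case])
    moreover have "(\<dots> has_sum theta3_null (- (p ^ 2)) * thX (p ^ 2) + 0 * 0) (UNIV \<times> UNIV)"
      by (intro has_sum_add has_sum_times has_sum_thX' has_sum_theta4 has_sum_zero p2)
    ultimately show ?thesis by simp
  qed
  ultimately have "thX p * thY p = thX (p ^ 2) * theta3_null (- (p ^ 2)) - 0 * 0 +
     (theta3_null (- (p ^ 2)) * thX (p ^ 2) + 0 * 0)"
    by (rule has_sum_parity_split)
  thus ?thesis by simp
qed

end

text \<open>\<open>Z\<close> collects the indices of exponent 0. In every other term one factor of
  the nome is pulled out, so the remainder is at most \<open>norm z / norm p\<close> times a fixed
  convergent sum.\<close>

lemma theta_like_tendsto:
  fixes p :: complex and c :: "int \<Rightarrow> complex"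
  assumes p: "0 < norm p" "norm p < 1"
    and sm: "(\<lambda>n. c n * p powi h n) summable_on UNIV"
    and h: "\<And>n. 0 \<le> h n" and Z: "finite Z" "\<And>n. h n = 0 \<longleftrightarrow> n \<in> Z"
  shows "(\<lambda>k. \<Sum>\<^sub>\<infinity>n. c n * (p ^ (2 ^ k)) powi h n) \<longlonglongrightarrow> sum c Z"
proof -
  define M where "M = (\<Sum>\<^sub>\<infinity>n. norm (c n * p powi h n))"
  have M: "((\<lambda>n. norm (c n * p powi h n)) has_sum M) UNIV"
    using sm unfolding M_def summable_on_iff_abs_summable_on_complex by (rule has_sum_infsum)
  have bound: "norm ((\<Sum>\<^sub>\<infinity>n. c n * z powi h n) - sum c Z) \<le> norm z / norm p * M"
    if z: "norm z \<le> norm p" for z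
  proof -
    let ?d = "\<lambda>n. if n \<in> Z then 0 else c n * z powi h n"
    have d: "norm (?d n) \<le> norm z / norm p * norm (c n * p powi h n)" for n
    proof (cases "n \<in> Z")
      case False
      define m where "m = nat (h n) - 1"
      have m: "nat (h n) = Suc m" using False Z(2)[of n] h[of n] unfolding m_def by (simp add: not_le order_less_le)
      have "norm z ^ m \<le> norm p ^ m" using z by (intro power_mono) auto
      hence "norm z * norm z ^ m \<le> norm z / norm p * (norm p * norm p ^ m)"
        using p by (simp add: mult_left_mono)
      hence "norm (z powi h n) \<le> norm z / norm p * norm (p powi h n)"
        using h[of n] m by (simp add: power_int_def norm_power norm_mult)
      from mult_left_mono[OF this, of "norm (c n)"] show ?thesis
        using False by (simp add: norm_mult mult_ac)
    qed (use p in simp)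
    have M': "((\<lambda>n. norm z / norm p * norm (c n * p powi h n)) has_sum norm z / norm p * M) UNIV"
      by (rule has_sum_cmult_right[OF M])
    have "(\<lambda>n. norm (?d n)) summable_on UNIV"
      by (rule Infinite_Sum.abs_summable_on_comparison_test'[OF _ d])
         (use M' in \<open>auto simp: summable_on_def\<close>)
    hence "?d summable_on UNIV" by (rule abs_summable_summable)
    then obtain D where D: "(?d has_sum D) UNIV" by (auto simp: summable_on_def)
    have le: "norm D \<le> norm z / norm p * M"
      using norm_infsum_le[OF D M'] d by auto
    have "((\<lambda>n. if n \<in> Z then c n else 0) has_sum sum c Z) UNIV"
      by (rule has_sum_finite_neutralI[OF Z(1)]) (auto intro: sum.cong)
    from has_sum_add[OF D this] have "((\<lambda>n. ?d n + (if n \<in> Z then c n else 0)) has_sum (D + sum c Z)) UNIV" .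
    also have "(\<lambda>n. ?d n + (if n \<in> Z then c n else 0)) = (\<lambda>n. c n * z powi h n)"
      using Z(2)[THEN iffD2] by (auto simp: fun_eq_iff)
    finally have "(\<Sum>\<^sub>\<infinity>n. c n * z powi h n) = D + sum c Z" by (rule infsumI)
    thus ?thesis using le by simp
  qed
  have lim: "(\<lambda>k. norm (p ^ (2 ^ k))) \<longlonglongrightarrow> 0"
  proof (rule tendsto_sandwich[of "\<lambda>_. 0" _ _ "\<lambda>k. norm p ^ k"])
    show "(\<lambda>k. norm p ^ k) \<longlonglongrightarrow> 0" using p by (intro LIMSEQ_realpow_zero) auto
    show "\<forall>\<^sub>F k in sequentially. norm (p ^ (2 ^ k)) \<le> norm p ^ k"
      using p by (intro always_eventually allI) (auto simp: norm_power intro!: power_decreasing less_imp_le[OF less_exp])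
  qed auto
  have "(\<lambda>k. (\<Sum>\<^sub>\<infinity>n. c n * (p ^ (2 ^ k)) powi h n) - sum c Z) \<longlonglongrightarrow> 0"
  proof (rule Lim_null_comparison)
    show "\<forall>\<^sub>F k in sequentially. norm ((\<Sum>\<^sub>\<infinity>n. c n * (p ^ (2 ^ k)) powi h n) - sum c Z) \<le> norm (p ^ (2 ^ k)) / norm p * M"
      using p power_decreasing[of 1 _ "norm p"]
      by (intro always_eventually allI bound) (auto simp: norm_power)
    show "(\<lambda>k. norm (p ^ (2 ^ k)) / norm p * M) \<longlonglongrightarrow> 0"
      using tendsto_mult[OF tendsto_divide[OF lim tendsto_const[of "norm p"]] tendsto_const[of M]] p by simp
  qed
  thus ?thesis by (simp add: LIM_zero_iff)
qed

text \<open>By \<open>theta4_square\<close> this is \<theta>_1' / (\<theta>_2 \<theta>_3 \<theta>_4)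
  at \<open>p\<close>, whose value 1 is Jacobi's derivative identity.\<close>

definition theta_ratio :: "complex \<Rightarrow> complex" where
  "theta_ratio p = 2 * thX p / (theta3_null (- (p ^ 2)) ^ 2 * thY p)"

definition theta_nonvanishing :: "complex \<Rightarrow> bool" where
  "theta_nonvanishing p \<longleftrightarrow> thX p \<noteq> 0 \<and> thY p \<noteq> 0 \<and> theta3_null (- (p ^ 2)) \<noteq> 0"

text \<open>No theta constant can vanish at \<open>p\<close> unless one vanishes at \<open>p\<^sup>2\<close>; this avoids product expansions.\<close>

lemma theta_descent:
  assumes p: "0 < norm p" "norm p < 1" and nz: "theta_nonvanishing (p ^ 2)"
  shows "theta_nonvanishing p" "theta_ratio (p ^ 2) = theta_ratio p"
proof -
  note 1 = thY_square[OF p] and 2 = theta4_square[OF p2[OF p]] and 3 = thX_thY[OF p]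
  define a b b2 where "a = theta3_null (p ^ 2)" and "b = theta3_null (- (p ^ 2))" 
    and "b2 = theta3_null (- ((p ^ 2) ^ 2))"
  note 1 = 1[folded a_def] and 2 = 2[folded a_def b_def b2_def] and 3 = 3[folded b_def]
  have nz2: "thX (p ^ 2) \<noteq> 0" "thY (p ^ 2) \<noteq> 0" "b2 \<noteq> 0" using nz by (auto simp: theta_nonvanishing_def b2_def)
  \<comment> \<open>The square identity at \<open>p ^ 2\<close> reads
    \<open>b2 ^ 2 = a * b\<close>.\<close>
  hence ab: "a \<noteq> 0" "b \<noteq> 0" using 2 by auto
  have XY: "thX p \<noteq> 0" "thY p \<noteq> 0" using 1 3 nz2 ab by auto
  show "theta_nonvanishing p" using ab XY by (simp add: theta_nonvanishing_def b_def)
  have X2: "thX (p ^ 2) = thX p * thY p / (2 * b)" using 3 ab by (simp add: field_simps)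
  have Y2: "thY (p ^ 2) = thY p ^ 2 / (2 * a)" using 1 ab by (simp add: field_simps)
  show "theta_ratio (p ^ 2) = theta_ratio p"
    unfolding theta_ratio_def b_def[symmetric] b2_def[symmetric] 2 X2 Y2
    using ab XY by (simp add: field_simps power2_eq_square)
qed

text \<open>Only exponent 0 survives: n = 0 and n = 1 for n^2 - n, where \<open>thX\<close> has
  weights 0 and 1, and n = 0 for the last series.\<close>

lemma theta_limits:
  assumes p: "0 < norm p" "norm p < 1"
  shows "(\<lambda>k. thX (p ^ (2 ^ k))) \<longlonglongrightarrow> 1" "(\<lambda>k. thY (p ^ (2 ^ k))) \<longlonglongrightarrow> 2"
    "(\<lambda>k. theta3_null (- ((p ^ (2 ^ k)) ^ 2))) \<longlonglongrightarrow> 1"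
proof -
  have Z: "n ^ 2 - n = 0 \<longleftrightarrow> n \<in> {0, 1}" and nn: "0 \<le> n ^ 2 - n" for n :: int
  proof -
    have eq: "n ^ 2 - n = n * (n - 1)" by (simp add: power2_eq_square algebra_simps)
    show "n ^ 2 - n = 0 \<longleftrightarrow> n \<in> {0, 1}" unfolding eq by auto
    show "0 \<le> n ^ 2 - n" unfolding eq zero_le_mult_iff by linarith
  qed
  show "(\<lambda>k. thX (p ^ (2 ^ k))) \<longlonglongrightarrow> 1"
    using theta_like_tendsto[OF p _ nn _ Z, of "\<lambda>n. of_int n * - sgn_pow n"] has_sum_thX[OF p]
    by (simp add: thX_def sgn_pow_def mult.assoc summable_on_def) blast
  show "(\<lambda>k. thY (p ^ (2 ^ k))) \<longlonglongrightarrow> 2"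
    using theta_like_tendsto[OF p _ nn _ Z, of "\<lambda>n. 1"] has_sum_thY[OF p]
    by (simp add: thY_def summable_on_def) blast
  have "(\<lambda>k. \<Sum>\<^sub>\<infinity>n. sgn_pow n * (p ^ (2 ^ k)) powi (2 * n ^ 2)) \<longlonglongrightarrow> sum sgn_pow {0}"
    by (rule theta_like_tendsto[OF p]) (auto intro: summable_theta_like(1)[OF p abs_mult_pred_le(4)])
  thus "(\<lambda>k. theta3_null (- ((p ^ (2 ^ k)) ^ 2))) \<longlonglongrightarrow> 1"
    by (simp add: theta3_null_def minus_powi_square power2_powi sgn_pow_def)
qed

lemma thX_eq:
  assumes p: "0 < norm p" "norm p < 1"
  shows "thY p \<noteq> 0" "2 * thX p = theta3_null (- (p ^ 2)) ^ 2 * thY p"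
proof -
  define z where "z k = p ^ (2 ^ k)" for k
  have z: "0 < norm (z k)" "norm (z k) < 1" for k
    using p by (simp_all add: z_def norm_power power_less_one_iff)
  have z_Suc: "z (Suc k) = z k ^ 2" for k by (simp add: z_def power_mult mult.commute flip: power_mult)
  note lim = theta_limits[OF p, folded z_def]
  have "eventually (\<lambda>k. theta_nonvanishing (z k)) sequentially"
    unfolding theta_nonvanishing_def
    by (intro eventually_conj tendsto_imp_eventually_ne[OF lim(1)] tendsto_imp_eventually_ne[OF lim(2)]
              tendsto_imp_eventually_ne[OF lim(3)]) auto
  then obtain K where K: "\<And>k. k \<ge> K \<Longrightarrow> theta_nonvanishing (z k)" by (auto simp: eventually_sequentially)
  \<comment> \<open>Nonvanishing holds for large \<open>k\<close> by the limits and descends to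
    every smaller \<open>k\<close>.\<close>
  have nz: "theta_nonvanishing (z k)" for k
  proof (cases "k \<le> K")
    case True
    thus ?thesis
    proof (induction rule: inc_induct)
      case (step n)
      thus ?case using theta_descent(1)[OF z, of n] by (simp add: z_Suc)
    qed (use K in auto)
  qed (use K in auto)
  have const: "theta_ratio (z k) = theta_ratio p" for k
  proof (induction k)
    case (Suc k)
    thus ?case using theta_descent(2)[OF z, of k] nz[of "Suc k"] by (simp add: z_Suc)
  qed (simp add: z_def)
  have "(\<lambda>k. theta_ratio (z k)) \<longlonglongrightarrow> 2 * 1 / (1 ^ 2 * 2)"
    unfolding theta_ratio_def by (intro tendsto_intros lim) auto
  hence "theta_ratio p = 1" using const LIMSEQ_unique[OF tendsto_const] by auto
  moreover have "theta_nonvanishing p" using nz[of 0] by (simp add: z_def)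
  ultimately show "thY p \<noteq> 0" "2 * thX p = theta3_null (- (p ^ 2)) ^ 2 * thY p"
    by (auto simp: theta_ratio_def theta_nonvanishing_def field_simps)
qed

subsection \<open>Conclusion\<close>

lemma laurent_minus: "laurent a (- x) = laurent (\<lambda>n. sgn_pow n * a n) x"
proof -
  have "a n * (- x) powi n = sgn_pow n * a n * x powi n" for n
    by (simp add: sgn_pow_def power_int_minus_left)
  thus ?thesis by (simp only: laurent_def)
qed

section \<open>The first derivative at the origin as a fourth power\<close>

lemma (in nome) A_1_0: "A 1 0 = - (theta3_null (- q) ^ 4) / 4"
proof -
  \<comment> \<open>With a square root of \<open>q\<close>, the coefficients p^(n^2 - n) gain
    exactly the factor q^n from n to n + 1.\<close>
  define p where "p = csqrt q"
  have p2: "p ^ 2 = q" by (simp add: p_def)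
  hence "norm p ^ 2 = norm q" by (simp flip: norm_power)
  hence p: "0 < norm p" "norm p < 1"
    using q power_less_one_iff[of "norm p" 2] by (auto simp: zero_less_power_eq)
  define th where "th n = p powi (n ^ 2 - n)" for n
  define v where "v n = sgn_pow n * th n" for n
  have sth: "laurent_summable (norm q) (1 / norm q) th"
    using laurent_summable_theta_like[OF p q abs_mult_pred_le(1), of "\<lambda>_. 1"] by (simp add: th_def[abs_def])
  have sv: "laurent_summable (norm q) (1 / norm q) v"
    using laurent_summable_theta_like[OF p q abs_mult_pred_le(1), of sgn_pow]
    by (simp add: v_def[abs_def] th_def[abs_def])
  have pnz: "p \<noteq> 0" using p by auto
  have th_Suc: "th (n + 1) = q powi n * th n" for n
    unfolding th_def p2[symmetric] power2_powi using pnz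
    by (simp add: power2_eq_square algebra_simps flip: power_int_add)
  have v_Suc: "v (n + 1) = - (q powi n * v n)" for n
    by (simp add: v_def th_Suc sgn_pow_def)
  have inner: "norm x < 1 / norm q" if "norm x < 1" for x :: complex
  proof -
    have "1 < 1 / norm q" using q by simp
    with that show ?thesis by linarith
  qed
  define P where "P n = (\<Sum>\<^sub>\<infinity>k. f k * v (n - k))" for n
  have P: "((\<lambda>k. f k * v (n - k)) has_sum P n) UNIV" for n
  proof -
    obtain x :: complex where x: "norm q < norm x" "norm x < 1" using ex_annulus by blast
    hence "x \<noteq> 0" using q by auto
    thus ?thesis unfolding P_def
      using laurent_mult(2)[OF summable_f[OF x] laurent_summableD[OF sv x(1) inner[OF x(2)]]]
      by (intro has_sum_infsum) auto
  qed
  \<comment> \<open>The recurrence of \<open>v\<close> produces \<open>1 + q powi k\<close>, which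
    cancels the denominator of \<open>f k\<close>; what remains is the theta series at -1, which is
    0.\<close>
  have P_Suc: "P (n + 1) = q powi n * P n" for n
  proof -
    have "((\<lambda>k. f k * v (n + 1 - k) - q powi n * (f k * v (n - k))) has_sum P (n + 1) - q powi n * P n) UNIV"
      by (intro has_sum_minus has_sum_cmult_right P)
    also have "(\<lambda>k. f k * v (n + 1 - k) - q powi n * (f k * v (n - k))) = (\<lambda>k. v (n + 1 - k))"
    proof
      fix k
      have qn: "q powi n = q powi (n - k) * q powi k" using q_nz by (simp flip: power_int_add)
      have "v (n + 1 - k) = - (q powi (n - k) * v (n - k))" using v_Suc[of "n - k"] by (simp add: algebra_simps)
      hence "f k * v (n + 1 - k) - q powi n * (f k * v (n - k)) =
             - (q powi (n - k) * v (n - k)) * ((1 + q powi k) * f k)"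
        unfolding qn by (simp add: algebra_simps)
      also have "(1 + q powi k) * f k = 1" using one_plus_powi_nz[of k] by (simp add: f_def)
      finally show "f k * v (n + 1 - k) - q powi n * (f k * v (n - k)) = v (n + 1 - k)"
        using v_Suc[of "n - k"] by (simp add: algebra_simps)
    qed
    finally have "((\<lambda>k. v (n + 1 - k)) has_sum P (n + 1) - q powi n * P n) UNIV" .
    moreover have "(v has_sum 0) UNIV"
      using has_sum_zero(1)[OF p] by (simp add: v_def[abs_def] th_def[abs_def])
    hence "((\<lambda>k. v (n + 1 - k)) has_sum 0) UNIV" by (subst has_sum_reflect)
    ultimately have "P (n + 1) - q powi n * P n = 0" by (rule has_sum_unique)
    thus ?thesis by simp
  qed
  \<comment> \<open>\<open>P\<close> and \<open>th\<close> obey the same recurrence and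
    \<open>th 0 = 1\<close>, so they differ by the factor \<open>P 0\<close>.\<close>
  define C where "C = P 0"
  have P_eq: "P n = C * th n" for n
  proof (induction n rule: int_induct[where k = 0])
    case base
    show ?case by (simp add: C_def th_def)
  next
    case (step1 i)
    thus ?case by (simp add: P_Suc th_Suc)
  next
    case (step2 i)
    have "q powi (i - 1) \<noteq> 0" using q_nz by simp
    moreover have "q powi (i - 1) * P (i - 1) = q powi (i - 1) * (C * th (i - 1))"
      using step2(2) P_Suc[of "i - 1"] th_Suc[of "i - 1"] by (metis diff_add_cancel mult.left_commute)
    ultimately show ?case by (metis mult_left_cancel)
  qed
  have key: "laurent f x * laurent v x = C * laurent th x" if x: "norm q < norm x" "norm x < 1" for x
  proof -
    have "x \<noteq> 0" using x q by auto
    have "((\<lambda>n. C * (th n * x powi n)) has_sum C * laurent th x) UNIV"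
      unfolding laurent_def
      by (intro has_sum_cmult_right has_sum_infsum laurent_summableD[OF sth] x inner)
    moreover have "((\<lambda>n. C * (th n * x powi n)) has_sum laurent f x * laurent v x) UNIV"
      using laurent_mult(1)[OF summable_f[OF x] laurent_summableD[OF sv x(1) inner[OF x(2)]] \<open>x \<noteq> 0\<close>]
      by (simp add: P_def[symmetric] P_eq mult.assoc)
    ultimately show ?thesis using has_sum_unique by blast
  qed
  \<comment> \<open>These are the t-derivatives of the theta series at \<open>exp t\<close> and
    \<open>- exp t\<close>; at \<open>t = 0\<close> they are read at 1 and -1.\<close>
  define V Th where "V j t = laurent (\<lambda>n. of_int n ^ j * th n) (1 * exp t)"
    and "Th j t = laurent (\<lambda>n. of_int n ^ j * th n) (- 1 * exp t)" for j t
  have V: "(V j has_field_derivative V (Suc j) t) (at t)"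
    and Th: "(Th j has_field_derivative Th (Suc j) t) (at t)"
    if "norm q < norm (exp t)" "norm (exp t) < 1 / norm q" for j t
    unfolding V_def Th_def using that
    by - (rule has_field_derivative_laurent_exp[OF sth]; simp)+
  define r where "r j t = laurent (\<lambda>n. of_int n ^ j * f_reg n) (1 * exp t)" for j t
  have r: "(r j has_field_derivative r (Suc j) t) (at t)"
    if "norm q < norm (exp t)" "norm (exp t) < 1 / norm q" for j t
    unfolding r_def using that by (intro has_field_derivative_laurent_exp[OF laurent_summable_f_reg]; simp)
  have TT: "norm q < norm (exp t)" "norm (exp t) < 1" "norm (exp t) < 1 / norm q" if "t \<in> T" for t
    using that exp_in_T[OF that] by (auto simp: T_def)
  have cont: "isCont (V j) 0" "isCont (Th j) 0" "isCont (r j) 0" for j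
    using DERIV_isCont[OF V[of 0 j]] DERIV_isCont[OF Th[of 0 j]] DERIV_isCont[OF r[of 0 j]] one_in_annulus
    by auto
  have vals: "V 0 0 = thY p" "Th 0 0 = 0" "Th 1 0 = - thX p"
  proof -
    show "V 0 0 = thY p" by (simp add: V_def laurent_def th_def thY_def)
    show "Th 0 0 = 0"
      using infsumI[OF has_sum_zero(1)[OF p]]
      by (simp add: Th_def laurent_def th_def mult.commute flip: sgn_pow_eq)
    have "((\<lambda>n. - (of_int n * (- sgn_pow n * p powi (n ^ 2 - n)))) has_sum - thX p) UNIV"
      using has_sum_thX[OF p] by (simp only: has_sum_uminus minus_minus)
    thus "Th 1 0 = - thX p"
      by (auto intro!: infsumI simp: Th_def laurent_def th_def mult_ac simp flip: sgn_pow_eq)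
  qed
  \<comment> \<open>This is \<open>key\<close> at \<open>- exp t\<close>, where \<Phi> is regular at
    the origin; its derivative at 0 gives \<open>A 1 0 * thY p = - C * thX p\<close>.\<close>
  have 1: "A 0 t * V 0 t = C * Th 0 t" if "t \<in> T" for t
    using key[of "- exp t"] TT[OF that] A_eq[OF that, of 0] laurent_minus[of th "- exp t"]
    by (simp add: V_def Th_def v_def[abs_def])
  have "A 1 t * V 0 t + A 0 t * V 1 t = C * Th 1 t" if "t \<in> T" for t
    by (rule deriv_unique_on_open[OF open_T that 1])
       (use that TT in \<open>auto intro!: derivative_eq_intros A_deriv V Th\<close>)
  hence "A 1 0 * V 0 0 + A 0 0 * V 1 0 = C * Th 1 0"
    by (rule eq_at_0[of "\<lambda>t. A 1 t * V 0 t + A 0 t * V 1 t"])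
       (auto intro!: continuous_intros cont isCont_A)
  hence AX: "A 1 0 * thY p = - C * thX p" by (simp add: vals A_values(1) del: One_nat_def)
  \<comment> \<open>This is \<open>key\<close> at \<open>exp t\<close>, multiplied by
    \<open>1 - exp t\<close> to clear the pole of \<Phi> at x = 1; its derivative at 0 gives
    \<open>C * thY p = thX p\<close>.\<close>
  have 2: "(1 + (1 - exp t) * (r 0 t - 1 / 2)) * Th 0 t = (1 - exp t) * (C * V 0 t)" if "t \<in> T" for t
  proof -
    have nz: "exp t \<noteq> 1" using TT(2)[OF that] by (metis norm_one less_irrefl)
    have "((\<lambda>n. f_reg n * exp t powi n + half_step n * exp t powi n) has_sum
             laurent f_reg (exp t) + (1 / (1 - exp t) - 1 / 2)) UNIV"
      unfolding laurent_def
      by (intro has_sum_add has_sum_infsum has_sum_half_step laurent_summableD[OF laurent_summable_f_reg] TT that)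
    hence "laurent f (exp t) = laurent f_reg (exp t) + (1 / (1 - exp t) - 1 / 2)"
      unfolding laurent_def[of f] by (intro infsumI) (simp add: f_reg_def algebra_simps)
    hence "(1 - exp t) * laurent f (exp t) = 1 + (1 - exp t) * (r 0 t - 1 / 2)"
      using nz by (simp add: r_def field_simps)
    moreover have "laurent f (exp t) * Th 0 t = C * V 0 t"
      using key[of "exp t"] TT[OF that] laurent_minus[of th "exp t"] by (simp add: V_def Th_def v_def[abs_def])
    ultimately show ?thesis by (metis mult.assoc)
  qed
  have "(- exp t * (r 0 t - 1 / 2) + (1 - exp t) * r 1 t) * Th 0 t + (1 + (1 - exp t) * (r 0 t - 1 / 2)) * Th 1 t
      = - exp t * (C * V 0 t) + (1 - exp t) * (C * V 1 t)" if "t \<in> T" for t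
    by (rule deriv_unique_on_open[OF open_T that 2])
       (use that TT in \<open>auto intro!: derivative_eq_intros V Th r simp: field_simps\<close>)
  hence "(- exp 0 * (r 0 0 - 1 / 2) + (1 - exp 0) * r 1 0) * Th 0 0 + (1 + (1 - exp 0) * (r 0 0 - 1 / 2)) * Th 1 0
      = - exp 0 * (C * V 0 0) + (1 - exp 0) * (C * V 1 0)"
    by (rule eq_at_0[of "\<lambda>t. (- exp t * (r 0 t - 1 / 2) + (1 - exp t) * r 1 t) * Th 0 t + (1 + (1 - exp t) * (r 0 t - 1 / 2)) * Th 1 t"])
       (auto intro!: continuous_intros cont)
  hence CX: "C * thY p = thX p" by (simp add: vals del: One_nat_def)
  \<comment> \<open>Jacobi's identity now determines \<open>C\<close>, and eliminating
    \<open>thX p\<close> gives \<open>A 1 0 = - C * C\<close>.\<close>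
  note th = thX_eq[OF p, unfolded p2]
  have "2 * C * thY p = theta3_null (- q) ^ 2 * thY p" using CX th(2) by (simp add: mult.assoc)
  hence "C = theta3_null (- q) ^ 2 / 2" using th(1) by (simp add: field_simps)
  moreover have "A 1 0 * thY p = (- C * C) * thY p" using AX unfolding CX[symmetric] by (simp add: mult.assoc)
  hence "A 1 0 = - C * C" using th(1) mult_right_cancel by blast
  ultimately have "A 1 0 = - (theta3_null (- q) ^ 2 / 2) * (theta3_null (- q) ^ 2 / 2)" by (simp only:)
  thus ?thesis by (simp add: power2_eq_square power4_eq_xxxx)
qed

section \<open>Evaluation of both determinants\<close>

theorem theorem1p6:
  fixes q :: complex
  assumes "0 < norm q" and "norm q < 1"
  shows "theta3_null (- q) ^ 16 =
           1 / 3 * det (vector [vector [16 * U 1 q - 2, 16 * U 3 q + 1],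
                                vector [16 * U 3 q + 1, 16 * U 5 q - 2]] :: complex ^ 2 ^ 2)
       \<and> theta3_null (- q) ^ 24 =
           1 / 3 ^ 2 * det (vector [vector [16 * G 3 q + 1, 16 * G 5 q - 2],
                                    vector [32 * G 5 q - 4, 32 * G 7 q + 17]] :: complex ^ 2 ^ 2)"
proof -
  interpret nome q by unfold_locales (use assms in auto)
  define x d1 d3 d5 where "x = theta3_null (- q) ^ 4" and "d1 = A 1 0" and "d3 = A 3 0" and "d5 = A 5 0"
  have x: "x = - 4 * d1" using A_1_0 by (simp add: x_def d1_def)
  have U: "16 * U 1 q - 2 = 8 * d1" "16 * U 3 q + 1 = 8 * d3" "16 * U 5 q - 2 = 8 * d5"
    unfolding d1_def d3_def d5_def A_values by simp_all
  have d: "d3 = - 2 * E * d1" "d5 = 12 * d1 ^ 3 - 2 * E * d3"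
    using relations_at_0(1,2) by (simp_all add: d1_def d3_def d5_def)
  have det: "d1 * d5 - d3 ^ 2 = 12 * d1 ^ 4"
  proof -
    \<comment> \<open>Only one factor \<open>d3\<close> is expanded, so that \<open>E\<close>
      cancels against the term \<open>- 2 * E * d1 * d3\<close> of \<open>d1 * d5\<close>.\<close>
    have "d3 ^ 2 = d3 * (- 2 * E * d1)" by (subst power2_eq_square, subst (2) d(1), rule refl)
    thus ?thesis unfolding d(2) by (simp add: algebra_simps eval_nat_numeral)
  qed
  have B: "2 * G 3 q + 1 / 8 = 2 * d1 ^ 2" "2 * G 5 q - 1 / 4 = 8 * d1 * d3"
          "2 * G 7 q + 17 / 16 = 20 * d3 ^ 2 + 12 * d1 * d5"
    using relations_at_0(3-5) unfolding B_values d1_def d3_def d5_def by simp_all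
  have "16 * G 3 q + 1 = 8 * (2 * G 3 q + 1 / 8)" "16 * G 5 q - 2 = 8 * (2 * G 5 q - 1 / 4)"
       "32 * G 5 q - 4 = 16 * (2 * G 5 q - 1 / 4)" "32 * G 7 q + 17 = 16 * (2 * G 7 q + 17 / 16)"
    by simp_all
  note G = this[unfolded B]
  have "det (vector [vector [16 * U 1 q - 2, 16 * U 3 q + 1],
                     vector [16 * U 3 q + 1, 16 * U 5 q - 2]] :: complex ^ 2 ^ 2) = 64 * (d1 * d5 - d3 ^ 2)"
    unfolding U by (simp add: det_2 power2_eq_square algebra_simps)
  moreover have "theta3_null (- q) ^ 16 = x ^ 4" "theta3_null (- q) ^ 24 = x ^ 6"
    by (simp_all add: x_def flip: power_mult)
  moreover have "det (vector [vector [16 * G 3 q + 1, 16 * G 5 q - 2],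
                         vector [32 * G 5 q - 4, 32 * G 7 q + 17]] :: complex ^ 2 ^ 2) =
              3072 * d1 ^ 2 * (d1 * d5 - d3 ^ 2)"
    unfolding G by (simp add: det_2 power2_eq_square algebra_simps)
  \<comment> \<open>The constants match because 64 * 12 / 3 = 4^4 and 3072 * 12 / 9 = 4^6.\<close>
  ultimately show ?thesis
    unfolding det x by (simp add: power_mult_distrib eval_nat_numeral)
qed

end
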